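(* Let $\sigma$ and $\Pi$ be as follows: $\chi=\chi_1\otimes\chi_2\otimes\chi_0$ is an unramified character of $T_{\mathbf H}(F)$ with $\chi_1\chi_2\chi_0^2=1$ and $|\cdot|^{\pm1}\notin\{\chi_1,\chi_2,\chi_1\chi_2,\chi_1\chi_2^{-1}\}$, $\sigma=I_{\mathbf H}(\chi)$, and $\Pi$ is an irreducible generic unramified representation of $\mathbf{PG}(F)$ which is the small theta lift of the $\psi$-generic irreducible $\mathbf H^+(F)$-constituent of $\sigma$. Let $\phi_0$ be a spherical vector of $\Pi$, $\Lambda$ the Shalika functional normalized as in the context, $\mathcal S_\Pi(g)=\Lambda(\Pi(g)\phi_0)$, and $f_s$ the unramified section described in the context. Then $$J(\phi_0,f_s,s):=\int_{\mathrm{GL}_2(F)N_{\mathbf H}(F)\backslash\mathbf H(F)}f_s(h)\,\mathcal S_\Pi(h)\,dh=L(s,\sigma,\mathrm{std}\otimes\chi_{E/F}),$$ where $L(s,\sigma,\mathrm{std}\otimes\chi_{E/F})=\prod_{\lambda\in\{t_1t_2,\,t_1t_2^{-1},\,1,\,t_1^{-1}t_2,\,t_1^{-1}t_2^{-1}\}}(1+\lambda q^{-s})^{-1}$.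
   Context: $F$ non-archimedean local field of characteristic zero, $\mathcal O$, uniformizer $\varpi$, $q=|\mathcal O/\varpi\mathcal O|$, $|\varpi|=q^{-1}$, $\zeta_F(s)=(1-q^{-s})^{-1}$. $E=F(\delta)$, $\bar\delta=-\delta$, is the unramified quadratic extension, $\chi_{E/F}$ its quadratic character ($\chi_{E/F}(\varpi)=-1$). $J_2=\left(\begin{smallmatrix}0&1\\1&0\end{smallmatrix}\right)$, $J=\left(\begin{smallmatrix}0&J_2\\-J_2&0\end{smallmatrix}\right)$; $\mathbf G(F)=\{(g,m)\in\mathrm{GL}_4(E)\times F^\times:\bar g^tJg=mJ\}\supset\mathbf H(F)=\mathrm{GSp}_4(F)$; $\mathbf H^+(F)$ = elements of $\mathbf H(F)$ with multiplier a norm from $E$. $T_{\mathbf H}$, $I_{\mathbf H}(\chi)$: $\chi(\mathrm{diag}(a,b,\nu b^{-1},\nu a^{-1}))=\chi_1(a)\chi_2(b)\chi_0(\nu)$, normalized induction from the upper triangular Borel. $P_{\mathbf H}=M_{\mathbf H}N_{\mathbf H}$ is the Siegel parabolic, $N_{\mathbf H}=\{\left(\begin{smallmatrix}1&0&a&x\\0&1&y&a\\0&0&1&0\\0&0&0&1\end{smallmatrix}\right)\}$, $\mathrm{GL}_2(F)$ embedded by $h\mapsto h^*=\left(\begin{smallmatrix}h&0\\0&\det(h)J_2{}^th^{-1}J_2\end{smallmatrix}\right)$, $\delta_{P_{\mathbf H}}\left(\left(\begin{smallmatrix}g&*\\0&\mu J_2{}^tg^{-1}J_2\end{smallmatrix}\right)\right)=|\det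 g/\mu|^3$. $f_s$ is the function in the (non-normalized) induction $\mathrm{Ind}_{P_{\mathbf H}(F)}^{\mathbf H(F)}(\delta_{P_{\mathbf H}}^{(s+1)/3})$ with $f_s(k)=\zeta_F(s+1)\zeta_F(2s)$ for $k\in\mathbf H(\mathcal O)$. Shalika functional: nonzero $\Lambda$ with $\Lambda(\Pi(h^*n)v)=\psi(\delta\alpha-\delta\bar\alpha)\Lambda(v)$ for $h\in\mathrm{GL}_2(F)$, $n=\left(\begin{smallmatrix}1&0&\alpha&x\\0&1&y&\bar\alpha\\0&0&1&0\\0&0&0&1\end{smallmatrix}\right)$ ($x,y\in F$, $\alpha\in E$), $\psi$ a fixed nontrivial additive character of $F$. Theta lift: via $\mathbf{PG}\simeq\mathrm{PGSO}_{4,2}$ and the induced Weil representation of $\mathbf{PH}^+(F)\times\mathbf{PG}(F)$ (Morimoto); $\psi$-generic refers to the fixed orbit of generic characters of the unipotent radical of the Borel of $\mathbf H^+(F)$ relevant to this correspondence. Normalization: $t_1=(\chi_1\chi_2\chi_0)(\varpi)$, $t_2=(\chi_1\chi_0)(\varpi)$, $g_\chi=\mathrm{diag}(t_1,t_2,t_2^{-1},t_1^{-1})$, $e^{a\check\alpha_1+b\check\alpha_2}(g_\chi)=t_1^at_2^b$, $\check\rho=2\check\alpha_1+\check\alpha_2$, $\mathcal A(f)=\sum_{\omega}\det(\omega)\,\omega(f)$ summed over the 8 signed permutations $\omega$ of the exponent $(a,b)$; $\Lambda$ is normalized so that for all $n\ge0$, $\mathcal S_\Pi(\mathrm{diag}(\varpi^nI_2,I_2))=\frac{q^{-2n}}{1+q^{-1}}\mathcal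 A\big((-1)^ne^{\check\rho+n(\check\alpha_1+\check\alpha_2)}(1+q^{-1}e^{-(\check\alpha_1+\check\alpha_2)})(1+q^{-1}e^{-(\check\alpha_1-\check\alpha_2)})\big)(g_\chi)/\mathcal A(e^{\check\rho})(g_\chi)$. The measure $dh$ is normalized so that $\int_{\mathrm{GL}_2N_{\mathbf H}\backslash\mathbf H}\Phi(h)dh=\int_{F^\times}\int_{\mathbf H(\mathcal O)}\delta_{P_{\mathbf H}}^{-1}(m(\mu))\Phi(m(\mu)k)\,dk\,d^\times\mu$, $m(\mu)=\mathrm{diag}(I_2,\mu I_2)$, with $\mathrm{vol}(\mathbf H(\mathcal O))=\mathrm{vol}(\mathcal O^\times)=1$.
   Formalization: The normalization of Λ uses 1/(1-q^{-1}) in place of 1/(1+q^{-1}) (as given, J is off by (1-q^{-1})/(1+q^{-1})); the character α↦ψ(δα-δᾱ) is assumed to have conductor O_E; s lies in the region of absolute convergence |λ|<q^{Re s}. *)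

theory Defs
  imports
    "HOL-Analysis.Analysis"
    "HOL-Algebra.Coset"
    "HOL-Library.Function_Algebras"
    "HOL-Library.Poly_Mapping"
begin

section \<open>Local fields\<close>

text \<open>Non-archimedean local fields of characteristic zero with their normalized absolute value,
  which also induces the metric.\<close>

class local_field = field_char_0 + complete_space +
  fixes absv :: "'a \<Rightarrow> real"
  assumes dist_absv: "dist x y = absv (x - y)"
    and absv_mult: "absv (x * y) = absv x * absv y"
    and absv_ultrametric: "absv (x + y) \<le> max (absv x) (absv y)"
    and finite_residue_classes:
      "finite ({x. absv x \<le> 1} // {(x, y). absv x \<le> 1 \<and> absv y \<le> 1 \<and> absv (x - y) < 1})"
    and ex_uniformizer:
      "\<exists>p. p \<noteq> 0 \<and> absv p = 1 / real (card
        ({x. absv x \<le> 1} // {(x, y). absv x \<le> 1 \<and> absv y \<le> 1 \<and> absv (x - y) < 1})) \<and>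
        (\<forall>x. absv x < 1 \<longrightarrow> absv x \<le> absv p)"

definition resq :: "'a::local_field itself \<Rightarrow> nat" where
  "resq _ =
     card ({x :: 'a. absv x \<le> 1} // {(x, y). absv x \<le> 1 \<and> absv y \<le> 1 \<and> absv (x - y) < 1})"

definition uniformizer :: "'a::local_field \<Rightarrow> bool" where
  "uniformizer p \<longleftrightarrow> p \<noteq> 0 \<and> absv p < 1 \<and> (\<forall>x :: 'a. absv x < 1 \<longrightarrow> absv x \<le> absv p)"

definition additive_character :: "('f::local_field \<Rightarrow> complex) \<Rightarrow> bool" where
  "additive_character \<psi> \<longleftrightarrow>
     continuous_on UNIV \<psi> \<and> (\<forall>x y. \<psi> (x + y) = \<psi> x * \<psi> y) \<and> (\<forall>x. norm (\<psi> x) = 1)"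

definition unramified_character :: "('f::local_field \<Rightarrow> complex) \<Rightarrow> bool" where
  "unramified_character \<chi>\<^sub>0 \<longleftrightarrow>
     (\<forall>x y. x \<noteq> 0 \<longrightarrow> y \<noteq> 0 \<longrightarrow> \<chi>\<^sub>0 (x * y) = \<chi>\<^sub>0 x * \<chi>\<^sub>0 y) \<and>
     (\<forall>x. x \<noteq> 0 \<longrightarrow> \<chi>\<^sub>0 x \<noteq> 0) \<and> (\<forall>x. absv x = 1 \<longrightarrow> \<chi>\<^sub>0 x = 1)"

definition zetaF :: "'f::local_field itself \<Rightarrow> complex \<Rightarrow> complex" where
  "zetaF F s = 1 / (1 - of_nat (resq F) powr (- s))"

text \<open>\<open>E = F(\<delta>)\<close>, with \<open>\<iota>\<close> the inclusion of \<open>F\<close> and \<open>cj\<close> the nontrivial automorphism.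
  Both fields carry their own normalized absolute value, whence the square.\<close>

locale unramified_quadratic_ext =
  fixes \<iota> :: "'f::local_field \<Rightarrow> 'e::local_field" and cj :: "'e \<Rightarrow> 'e" and \<delta> :: 'e
  assumes \<iota>_add: "\<iota> (x + y) = \<iota> x + \<iota> y" and \<iota>_mult: "\<iota> (x * y) = \<iota> x * \<iota> y" and \<iota>_one: "\<iota> 1 = 1"
    and cj_add: "cj (u + v) = cj u + cj v" and cj_mult: "cj (u * v) = cj u * cj v"
    and cj_\<iota>: "cj (\<iota> x) = \<iota> x" and cj_\<delta>: "cj \<delta> = - \<delta>"
    and \<delta>_notin: "\<delta> \<notin> range \<iota>"
    and generated: "\<exists>x y. u = \<iota> x + \<iota> y * \<delta>"
    and absv_\<iota>: "absv (\<iota> x) = (absv x)\<^sup>2"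
    and unramified: "uniformizer x \<Longrightarrow> uniformizer (\<iota> x)"

text \<open>Inverse of the inclusion; only applied to elements of \<open>F\<close>.\<close>

definition toF :: "('f \<Rightarrow> 'e) \<Rightarrow> 'e \<Rightarrow> 'f" where
  "toF \<iota> = inv_into UNIV \<iota>"

definition chi_EF :: "('f::local_field \<Rightarrow> 'e::local_field) \<Rightarrow> ('e \<Rightarrow> 'e) \<Rightarrow> 'f \<Rightarrow> complex" where
  "chi_EF \<iota> cj x = (if \<exists>e. \<iota> x = e * cj e then 1 else - 1)"


section \<open>Matrix groups\<close>

definition matrix_group :: "('a::semiring_1^'n^'n) set \<Rightarrow> ('a^'n^'n) monoid" where
  "matrix_group S = \<lparr>carrier = S, mult = (**), one = mat 1\<rparr>"

text \<open>\<open>mat4\<close> spells out the rows. The indices of type \<open>4\<close> are \<open>1, 2, 3, 4\<close>, where \<open>4 = 0\<close>;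
  the order of that type is not used.\<close>

definition pos4 :: "4 \<Rightarrow> nat" where
  "pos4 i = (if i = 1 then 0 else if i = 2 then 1 else if i = 3 then 2 else 3)"

definition mat4 :: "'a list list \<Rightarrow> 'a^4^4" where
  "mat4 r = (\<chi> i j. r ! pos4 i ! pos4 j)"

definition mat2 :: "'a \<Rightarrow> 'a \<Rightarrow> 'a \<Rightarrow> 'a \<Rightarrow> 'a^2^2" where
  "mat2 a b c d = (\<chi> i j. if i = 1 then (if j = 1 then a else b) else (if j = 1 then c else d))"

definition block :: "'a^2^2 \<Rightarrow> 'a^2^2 \<Rightarrow> 'a^2^2 \<Rightarrow> 'a^2^2 \<Rightarrow> 'a^4^4" where
  "block A B C D = mat4
     [[A$1$1, A$1$2, B$1$1, B$1$2],
      [A$2$1, A$2$2, B$2$1, B$2$2],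
      [C$1$1, C$1$2, D$1$1, D$1$2],
      [C$2$1, C$2$2, D$2$1, D$2$2]]"

definition J2 :: "'a::comm_ring_1^2^2" where
  "J2 = mat2 0 1 1 0"

definition J4 :: "'a::comm_ring_1^4^4" where
  "J4 = block 0 J2 (- J2) 0"

definition upper_triangular4 :: "'a::zero^4^4 \<Rightarrow> bool" where
  "upper_triangular4 g \<longleftrightarrow> g$2$1 = 0 \<and> g$3$1 = 0 \<and> g$3$2 = 0 \<and> g$4$1 = 0 \<and> g$4$2 = 0 \<and> g$4$3 = 0"

definition upper_unipotent4 :: "'a::zero_neq_one^4^4 \<Rightarrow> bool" where
  "upper_unipotent4 g \<longleftrightarrow> upper_triangular4 g \<and> (\<forall>i. g$i$i = 1)"

text \<open>The similitude factor is determined by the matrix, so the groups consist of matrices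
  rather than of pairs.\<close>

definition GSp4 :: "('f::local_field^4^4) set" where
  "GSp4 = {h. invertible h \<and> (\<exists>m. m \<noteq> 0 \<and> transpose h ** J4 ** h = mat m ** J4)}"

definition sim :: "'f::local_field^4^4 \<Rightarrow> 'f" where
  "sim h = (THE m. transpose h ** J4 ** h = mat m ** J4)"

definition GSp4_plus :: "('f::local_field \<Rightarrow> 'e::local_field) \<Rightarrow> ('e \<Rightarrow> 'e) \<Rightarrow> ('f^4^4) set" where
  "GSp4_plus \<iota> cj = {h \<in> GSp4. \<exists>e. \<iota> (sim h) = e * cj e}"

definition Sp4 :: "('f::local_field^4^4) set" where
  "Sp4 = {h \<in> GSp4. sim h = 1}"

definition GSp4_O :: "('f::local_field^4^4) set" where
  "GSp4_O = {h \<in> GSp4. (\<forall>i j. absv (h$i$j) \<le> 1) \<and> absv (sim h) = 1}"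

definition GU :: "('f::local_field \<Rightarrow> 'e::local_field) \<Rightarrow> ('e \<Rightarrow> 'e) \<Rightarrow> ('e^4^4) set" where
  "GU \<iota> cj = {g. invertible g \<and>
     (\<exists>m. m \<noteq> 0 \<and> transpose (map_matrix cj g) ** J4 ** g = mat (\<iota> m) ** J4)}"

definition simGU :: "('f::local_field \<Rightarrow> 'e::local_field) \<Rightarrow> ('e \<Rightarrow> 'e) \<Rightarrow> 'e^4^4 \<Rightarrow> 'f" where
  "simGU \<iota> cj g = (THE m. transpose (map_matrix cj g) ** J4 ** g = mat (\<iota> m) ** J4)"

definition GU_O :: "('f::local_field \<Rightarrow> 'e::local_field) \<Rightarrow> ('e \<Rightarrow> 'e) \<Rightarrow> ('e^4^4) set" where
  "GU_O \<iota> cj = {g \<in> GU \<iota> cj. (\<forall>i j. absv (g$i$j) \<le> 1) \<and> absv (simGU \<iota> cj g) = 1}"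

text \<open>\<open>levi h \<mu>\<close> runs through the Siegel Levi subgroup; \<open>hstar\<close> is the embedding \<open>h \<mapsto> h\<^sup>*\<close>.\<close>

definition levi :: "'a::field^2^2 \<Rightarrow> 'a \<Rightarrow> 'a^4^4" where
  "levi h m = block h 0 0 (mat m ** J2 ** transpose (matrix_inv h) ** J2)"

definition hstar :: "'a::field^2^2 \<Rightarrow> 'a^4^4" where
  "hstar h = levi h (det h)"

definition siegel_unip :: "'a::field \<Rightarrow> 'a \<Rightarrow> 'a \<Rightarrow> 'a \<Rightarrow> 'a^4^4" where
  "siegel_unip a x y b = block (mat 1) (mat2 a x y b) 0 (mat 1)"

definition m_mu :: "'a::field \<Rightarrow> 'a^4^4" where
  "m_mu u = block (mat 1) 0 0 (mat u)"

definition GL2_NH :: "('f::local_field^4^4) set" where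
  "GL2_NH = {hstar h ** siegel_unip a x y a | h a x y. invertible h}"

definition PH :: "('f::local_field^4^4) set" where
  "PH = {p \<in> GSp4. p$3$1 = 0 \<and> p$3$2 = 0 \<and> p$4$1 = 0 \<and> p$4$2 = 0}"

definition delta_PH :: "'f::local_field^4^4 \<Rightarrow> real" where
  "delta_PH p = absv (det (mat2 (p$1$1) (p$1$2) (p$2$1) (p$2$2)) / sim p) ^ 3"

definition BH :: "('f::local_field^4^4) set" where
  "BH = {b \<in> GSp4. upper_triangular4 b}"

text \<open>Modulus of \<open>diag(a, b, \<nu>/b, \<nu>/a) u\<close>: the product over the positive roots
  \<open>a/b, b\<^sup>2/\<nu>, ab/\<nu>, a\<^sup>2/\<nu>\<close>.\<close>

definition delta_BH :: "'f::local_field^4^4 \<Rightarrow> real" where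
  "delta_BH b = absv ((b$1$1)^4 * (b$2$2)^2 / (sim b)^3)"


section \<open>Smooth representations\<close>

definition fscale :: "complex \<Rightarrow> ('x \<Rightarrow> complex) \<Rightarrow> 'x \<Rightarrow> complex" where
  "fscale c f = (\<lambda>x. c * f x)"

definition fscale2 :: "complex \<Rightarrow> ('y \<Rightarrow> 'x \<Rightarrow> complex) \<Rightarrow> 'y \<Rightarrow> 'x \<Rightarrow> complex" where
  "fscale2 c f = (\<lambda>y x. c * f y x)"

definition linear_on ::
  "(complex \<Rightarrow> 'v::ab_group_add \<Rightarrow> 'v) \<Rightarrow> 'v set \<Rightarrow> (complex \<Rightarrow> 'w::ab_group_add \<Rightarrow> 'w) \<Rightarrow> ('v \<Rightarrow> 'w) \<Rightarrow> bool" where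
  "linear_on sc V sc' T \<longleftrightarrow>
     (\<forall>x\<in>V. \<forall>y\<in>V. T (x + y) = T x + T y) \<and> (\<forall>c. \<forall>x\<in>V. T (sc c x) = sc' c (T x))"

definition smooth_rep ::
  "('g::topological_space) monoid \<Rightarrow> (complex \<Rightarrow> 'v::ab_group_add \<Rightarrow> 'v) \<Rightarrow> 'v set \<Rightarrow> ('g \<Rightarrow> 'v \<Rightarrow> 'v) \<Rightarrow> bool" where
  "smooth_rep G sc V \<rho> \<longleftrightarrow> vector_space sc \<and> module.subspace sc V \<and>
     (\<forall>g\<in>carrier G. linear_on sc V sc (\<rho> g) \<and> \<rho> g ` V \<subseteq> V) \<and>
     (\<forall>v\<in>V. \<rho> \<one>\<^bsub>G\<^esub> v = v) \<and>
     (\<forall>g\<in>carrier G. \<forall>h\<in>carrier G. \<forall>v\<in>V. \<rho> (g \<otimes>\<^bsub>G\<^esub> h) v = \<rho> g (\<rho> h v)) \<and>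
     (\<forall>v\<in>V. openin (top_of_set (carrier G)) {g \<in> carrier G. \<rho> g v = v})"

definition subrep ::
  "'g monoid \<Rightarrow> (complex \<Rightarrow> 'v::ab_group_add \<Rightarrow> 'v) \<Rightarrow> 'v set \<Rightarrow> ('g \<Rightarrow> 'v \<Rightarrow> 'v) \<Rightarrow> 'v set \<Rightarrow> bool" where
  "subrep G sc V \<rho> W \<longleftrightarrow> module.subspace sc W \<and> W \<subseteq> V \<and> (\<forall>g\<in>carrier G. \<rho> g ` W \<subseteq> W)"

definition irreducible_rep ::
  "'g monoid \<Rightarrow> (complex \<Rightarrow> 'v::ab_group_add \<Rightarrow> 'v) \<Rightarrow> 'v set \<Rightarrow> ('g \<Rightarrow> 'v \<Rightarrow> 'v) \<Rightarrow> bool" where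
  "irreducible_rep G sc V \<rho> \<longleftrightarrow> V \<noteq> {0} \<and> (\<forall>W. subrep G sc V \<rho> W \<longrightarrow> W = {0} \<or> W = V)"

definition intertwines_onto ::
  "'g monoid \<Rightarrow> (complex \<Rightarrow> 'v::ab_group_add \<Rightarrow> 'v) \<Rightarrow> 'v set \<Rightarrow> ('g \<Rightarrow> 'v \<Rightarrow> 'v) \<Rightarrow>
   (complex \<Rightarrow> 'w::ab_group_add \<Rightarrow> 'w) \<Rightarrow> 'w set \<Rightarrow> ('g \<Rightarrow> 'w \<Rightarrow> 'w) \<Rightarrow> ('v \<Rightarrow> 'w) \<Rightarrow> bool" where
  "intertwines_onto G sc V \<rho> sc' W \<rho>' T \<longleftrightarrow> linear_on sc V sc' T \<and> T ` V = W \<and>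
     (\<forall>g\<in>carrier G. \<forall>v\<in>V. T (\<rho> g v) = \<rho>' g (T v))"

text \<open>\<open>(W, \<rho>')\<close> is an irreducible subquotient of \<open>(V, \<rho>)\<close>.\<close>

definition irreducible_constituent ::
  "('g::topological_space) monoid \<Rightarrow> (complex \<Rightarrow> 'v::ab_group_add \<Rightarrow> 'v) \<Rightarrow> 'v set \<Rightarrow> ('g \<Rightarrow> 'v \<Rightarrow> 'v) \<Rightarrow>
   (complex \<Rightarrow> 'w::ab_group_add \<Rightarrow> 'w) \<Rightarrow> 'w set \<Rightarrow> ('g \<Rightarrow> 'w \<Rightarrow> 'w) \<Rightarrow> bool" where
  "irreducible_constituent G sc V \<rho> sc' W \<rho>' \<longleftrightarrow>
     smooth_rep G sc' W \<rho>' \<and> irreducible_rep G sc' W \<rho>' \<and>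
     (\<exists>V1 T. subrep G sc V \<rho> V1 \<and> intertwines_onto G sc V1 \<rho> sc' W \<rho>' T)"

text \<open>Functions on a group are extended by zero to the ambient type.\<close>

definition rtrans :: "'g monoid \<Rightarrow> 'g \<Rightarrow> ('g \<Rightarrow> 'a::zero) \<Rightarrow> 'g \<Rightarrow> 'a" where
  "rtrans G g f = (\<lambda>x. if x \<in> carrier G then f (x \<otimes>\<^bsub>G\<^esub> g) else 0)"

definition smooth_ind :: "('g::topological_space) monoid \<Rightarrow> 'g set \<Rightarrow> ('g \<Rightarrow> complex) \<Rightarrow> ('g \<Rightarrow> complex) set" where
  "smooth_ind G P \<theta> = {f. (\<forall>x. x \<notin> carrier G \<longrightarrow> f x = 0) \<and>
     (\<forall>p\<in>P. \<forall>x\<in>carrier G. f (p \<otimes>\<^bsub>G\<^esub> x) = \<theta> p * f x) \<and>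
     openin (top_of_set (carrier G)) {g \<in> carrier G. rtrans G g f = f}}"

definition smooth_dual ::
  "('g::topological_space) monoid \<Rightarrow> (complex \<Rightarrow> 'v::ab_group_add \<Rightarrow> 'v) \<Rightarrow> ('g \<Rightarrow> 'v \<Rightarrow> 'v) \<Rightarrow> ('v \<Rightarrow> complex) set" where
  "smooth_dual G sc \<rho> = {l. linear_on sc UNIV (*) l \<and>
     openin (top_of_set (carrier G)) {g \<in> carrier G. \<forall>v. l (\<rho> g v) = l v}}"

definition dual_action :: "'g monoid \<Rightarrow> ('g \<Rightarrow> 'v \<Rightarrow> 'v) \<Rightarrow> 'g \<Rightarrow> ('v \<Rightarrow> complex) \<Rightarrow> 'v \<Rightarrow> complex" where
  "dual_action G \<rho> g l = (\<lambda>v. l (\<rho> (inv\<^bsub>G\<^esub> g) v))"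

text \<open>The normalized induction \<open>I(\<chi>)\<close> on \<open>GSp\<^sub>4(F)\<close>.\<close>

definition I_H :: "('f::local_field \<Rightarrow> complex) \<Rightarrow> ('f \<Rightarrow> complex) \<Rightarrow> ('f \<Rightarrow> complex) \<Rightarrow> ('f^4^4 \<Rightarrow> complex) set" where
  "I_H \<chi>\<^sub>1 \<chi>\<^sub>2 \<chi>\<^sub>0 = smooth_ind (matrix_group GSp4) BH
     (\<lambda>b. of_real (sqrt (delta_BH b)) * (\<chi>\<^sub>1 (b$1$1) * \<chi>\<^sub>2 (b$2$2) * \<chi>\<^sub>0 (sim b)))"

definition generic_GU ::
  "('f::local_field \<Rightarrow> 'e::local_field) \<Rightarrow> ('e \<Rightarrow> 'e) \<Rightarrow> ('f \<Rightarrow> complex) \<Rightarrow>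
   (complex \<Rightarrow> 'v::ab_group_add \<Rightarrow> 'v) \<Rightarrow> ('e^4^4 \<Rightarrow> 'v \<Rightarrow> 'v) \<Rightarrow> bool" where
  "generic_GU \<iota> cj \<psi> sc \<Pi>\<^sub>G \<longleftrightarrow>
     (\<exists>a b l. a \<noteq> 0 \<and> b \<noteq> 0 \<and> linear_on sc UNIV (*) l \<and> (\<exists>v. l v \<noteq> 0) \<and>
       (\<forall>u\<in>GU \<iota> cj. upper_unipotent4 u \<longrightarrow>
          (\<forall>v. l (\<Pi>\<^sub>G u v) = \<psi> (toF \<iota> (a * u$1$2 + cj (a * u$1$2)) + b * toF \<iota> (u$2$3)) * l v)))"

text \<open>The generic characters of the unipotent radical fall into two orbits under the torus of
  \<open>H\<^sup>+(F)\<close>, according to the class in \<open>F\<^sup>\<times>/N(E\<^sup>\<times>)\<close> of the coefficient of \<open>u$2$3\<close>. The relevant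
  orbit is that of the values of the anisotropic kernel of the quadratic space used for the theta
  lift, which below is the norm form of \<open>E/F\<close>.\<close>

definition psi_generic ::
  "('f::local_field \<Rightarrow> complex) \<Rightarrow> (complex \<Rightarrow> 'w::ab_group_add \<Rightarrow> 'w) \<Rightarrow> ('f^4^4 \<Rightarrow> 'w \<Rightarrow> 'w) \<Rightarrow> bool" where
  "psi_generic \<psi> sc \<pi> \<longleftrightarrow>
     (\<exists>l. linear_on sc UNIV (*) l \<and> (\<exists>v. l v \<noteq> 0) \<and>
       (\<forall>u\<in>Sp4. upper_unipotent4 u \<longrightarrow> (\<forall>v. l (\<pi> u v) = \<psi> (u$1$2 + u$2$3) * l v)))"


section \<open>Haar measures\<close>

definition haar_measure :: "('g::topological_space) monoid \<Rightarrow> 'g measure \<Rightarrow> bool" where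
  "haar_measure G M \<longleftrightarrow> space M = carrier G \<and> sets M = sets (restrict_space borel (carrier G)) \<and>
     (\<forall>g\<in>carrier G. \<forall>A\<in>sets M. emeasure M ((\<lambda>x. g \<otimes>\<^bsub>G\<^esub> x) ` A) = emeasure M A) \<and>
     (\<forall>C. compact C \<longrightarrow> C \<subseteq> carrier G \<longrightarrow> emeasure M C < \<infinity>) \<and>
     (\<forall>U. openin (top_of_set (carrier G)) U \<longrightarrow> U \<noteq> {} \<longrightarrow> 0 < emeasure M U)"

definition add_group :: "'a::ab_group_add monoid" where
  "add_group = \<lparr>carrier = UNIV, mult = (+), one = 0\<rparr>"

definition unit_group :: "'a::field monoid" where
  "unit_group = \<lparr>carrier = {x. x \<noteq> 0}, mult = (*), one = 1\<rparr>"


section \<open>Theta lifts from \<open>H\<^sup>+(F)\<close> to \<open>PG(F) = PGSO\<^sub>4\<^sub>,\<^sub>2(F)\<close>\<close>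

text \<open>The quadratic space. The involution
  \<open>B \<mapsto> (J\<^sup>-\<^sup>1 cj(B) J)^\<close> of the skew-symmetric matrices over \<open>E\<close>, where \<open>^\<close> is the adjoint for the
  Pfaffian, satisfies \<open>(g B \<^sup>tg)' = m(g)\<^sup>2 det(g)\<^sup>-\<^sup>1 g B' \<^sup>tg\<close> on \<open>G(F)\<close>. Its fixed vectors are the
  matrices \<open>Bmat x\<close>, and the Pfaffian restricts to a form of signature \<open>(4,2)\<close> on them,
  namely two hyperbolic planes plus the norm form of \<open>E/F\<close>.\<close>

definition Bmat :: "('f::local_field \<Rightarrow> 'e::local_field) \<Rightarrow> 'e \<Rightarrow> 'f^6 \<Rightarrow> 'e^4^4" where
  "Bmat \<iota> \<delta> x =
     (let b12 = \<delta> * \<iota> (x$1); b13 = \<delta> * \<iota> (x$2); b14 = \<iota> (x$3) + \<delta> * \<iota> (x$4);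
          b23 = \<iota> (x$3) - \<delta> * \<iota> (x$4); b24 = \<delta> * \<iota> (x$5); b34 = \<delta> * \<iota> (x$6)
      in mat4 [[0, b12, b13, b14],
               [- b12, 0, b23, b24],
               [- b13, - b23, 0, b34],
               [- b14, - b24, - b34, 0]])"

definition pfaffian4 :: "'a::comm_ring_1^4^4 \<Rightarrow> 'a" where
  "pfaffian4 B = B$1$2 * B$3$4 - B$1$3 * B$2$4 + B$1$4 * B$2$3"

definition qV :: "('f::local_field \<Rightarrow> 'e::local_field) \<Rightarrow> 'e \<Rightarrow> 'f^6 \<Rightarrow> 'f" where
  "qV \<iota> \<delta> x = toF \<iota> (pfaffian4 (Bmat \<iota> \<delta> x))"

definition bV :: "('f::local_field \<Rightarrow> 'e::local_field) \<Rightarrow> 'e \<Rightarrow> 'f^6 \<Rightarrow> 'f^6 \<Rightarrow> 'f" where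
  "bV \<iota> \<delta> x y = qV \<iota> \<delta> (x + y) - qV \<iota> \<delta> x - qV \<iota> \<delta> y"

definition GSO :: "('f::local_field \<Rightarrow> 'e::local_field) \<Rightarrow> 'e \<Rightarrow> ('f^6^6) set" where
  "GSO \<iota> \<delta> = {T. \<exists>c. c \<noteq> 0 \<and> (\<forall>x. qV \<iota> \<delta> (T *v x) = c * qV \<iota> \<delta> x) \<and> det T = c ^ 3}"

definition simV :: "('f::local_field \<Rightarrow> 'e::local_field) \<Rightarrow> 'e \<Rightarrow> 'f^6^6 \<Rightarrow> 'f" where
  "simV \<iota> \<delta> T = (THE c. \<forall>x. qV \<iota> \<delta> (T *v x) = c * qV \<iota> \<delta> x)"

text \<open>The isomorphism of \<open>PG(F)\<close> with \<open>PGSO\<^sub>4\<^sub>,\<^sub>2(F)\<close>, as a relation between representatives.\<close>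

definition PG_PGSO :: "('f::local_field \<Rightarrow> 'e::local_field) \<Rightarrow> ('e \<Rightarrow> 'e) \<Rightarrow> 'e \<Rightarrow> 'e^4^4 \<Rightarrow> 'f^6^6 \<Rightarrow> bool" where
  "PG_PGSO \<iota> cj \<delta> g T \<longleftrightarrow> g \<in> GU \<iota> cj \<and> T \<in> GSO \<iota> \<delta> \<and>
     (\<exists>e. e \<noteq> 0 \<and> (\<forall>x. Bmat \<iota> \<delta> (T *v x) = mat e ** g ** Bmat \<iota> \<delta> x ** transpose g))"

type_synonym 'f schwartz = "'f^2^6 \<Rightarrow> complex"

text \<open>A pair of vectors of the quadratic space is a matrix with two columns.\<close>

definition schwartz :: "('f::local_field) schwartz set" where
  "schwartz = {\<phi>. (\<forall>x. \<exists>U. open U \<and> x \<in> U \<and> (\<forall>y\<in>U. \<phi> y = \<phi> x)) \<and>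
     (\<exists>C. compact C \<and> (\<forall>x. x \<notin> C \<longrightarrow> \<phi> x = 0))}"

text \<open>The Schroedinger model of the Weil representation of \<open>Sp\<^sub>4(F)\<close>. The formula for \<open>siegel_unip\<close>
  is \<open>\<psi>(tr(b Q(x)))\<close> with \<open>b = [[x', a], [a, y']]\<close> and \<open>Q\<close> half the Gram matrix. The constant \<open>c\<close>
  (a Weil index, adjusted to the choice of the Haar measure) is forced by multiplicativity, as
  \<open>Sp\<^sub>4(F)\<close> is perfect; for the same reason \<open>\<omega>\<close> is unique.\<close>

definition weil_rep ::
  "('f::local_field \<Rightarrow> 'e::local_field) \<Rightarrow> ('e \<Rightarrow> 'e) \<Rightarrow> 'e \<Rightarrow> ('f \<Rightarrow> complex) \<Rightarrow>
   ('f^4^4 \<Rightarrow> 'f schwartz \<Rightarrow> 'f schwartz) \<Rightarrow> bool" where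
  "weil_rep \<iota> cj \<delta> \<psi> \<omega> \<longleftrightarrow>
     smooth_rep (matrix_group Sp4) fscale schwartz \<omega> \<and>
     (\<forall>\<phi>\<in>schwartz. \<forall>A. invertible A \<longrightarrow>
        \<omega> (levi A 1) \<phi> = (\<lambda>x. chi_EF \<iota> cj (det A) * of_real (absv (det A) ^ 3) * \<phi> (x ** A))) \<and>
     (\<forall>\<phi>\<in>schwartz. \<forall>a x' y'.
        \<omega> (siegel_unip a x' y' a) \<phi> =
          (\<lambda>x. \<psi> (x' * qV \<iota> \<delta> (column 1 x) + a * bV \<iota> \<delta> (column 1 x) (column 2 x)
                  + y' * qV \<iota> \<delta> (column 2 x)) * \<phi> x)) \<and>
     (\<exists>M c. haar_measure add_group M \<and> c \<noteq> 0 \<and>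
        (\<forall>\<phi>\<in>schwartz. \<omega> J4 \<phi> =
          (\<lambda>x. c * (\<integral>y. \<phi> y * \<psi> (bV \<iota> \<delta> (column 1 x) (column 1 y)
                                  + bV \<iota> \<delta> (column 2 x) (column 2 y)) \<partial>M))))"

definition RH_GSO :: "('f::local_field \<Rightarrow> 'e::local_field) \<Rightarrow> ('e \<Rightarrow> 'e) \<Rightarrow> 'e \<Rightarrow> (('f^4^4) \<times> ('f^6^6)) set" where
  "RH_GSO \<iota> cj \<delta> = {(h, T). h \<in> GSp4_plus \<iota> cj \<and> T \<in> GSO \<iota> \<delta> \<and> sim h = simV \<iota> \<delta> T}"

definition weil_ext ::
  "('f::local_field \<Rightarrow> 'e::local_field) \<Rightarrow> 'e \<Rightarrow> ('f^4^4 \<Rightarrow> 'f schwartz \<Rightarrow> 'f schwartz) \<Rightarrow>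
   ('f^4^4) \<times> ('f^6^6) \<Rightarrow> 'f schwartz \<Rightarrow> 'f schwartz" where
  "weil_ext \<iota> \<delta> \<omega> = (\<lambda>(h, T) \<phi>.
     \<omega> (h ** m_mu (inverse (sim h)))
       (\<lambda>x. of_real (inverse (absv (simV \<iota> \<delta> T)) ^ 3) * \<phi> (matrix_inv T ** x)))"

definition HGSO :: "('f::local_field \<Rightarrow> 'e::local_field) \<Rightarrow> ('e \<Rightarrow> 'e) \<Rightarrow> 'e \<Rightarrow> (('f^4^4) \<times> ('f^6^6)) monoid" where
  "HGSO \<iota> cj \<delta> = matrix_group (GSp4_plus \<iota> cj) \<times>\<times> matrix_group (GSO \<iota> \<delta>)"

text \<open>The induced Weil representation: compact induction of \<open>weil_ext\<close> from \<open>RH_GSO\<close>, with right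
  translations acting.\<close>

definition Omega ::
  "('f::local_field \<Rightarrow> 'e::local_field) \<Rightarrow> ('e \<Rightarrow> 'e) \<Rightarrow> 'e \<Rightarrow> ('f^4^4 \<Rightarrow> 'f schwartz \<Rightarrow> 'f schwartz) \<Rightarrow>
   (('f^4^4) \<times> ('f^6^6) \<Rightarrow> 'f schwartz) set" where
  "Omega \<iota> cj \<delta> \<omega> = {\<Phi>.
     (\<forall>z. z \<notin> carrier (HGSO \<iota> cj \<delta>) \<longrightarrow> \<Phi> z = 0) \<and>
     (\<forall>z\<in>carrier (HGSO \<iota> cj \<delta>). \<Phi> z \<in> schwartz) \<and>
     (\<forall>r\<in>RH_GSO \<iota> cj \<delta>. \<forall>z\<in>carrier (HGSO \<iota> cj \<delta>).
        \<Phi> (r \<otimes>\<^bsub>HGSO \<iota> cj \<delta>\<^esub> z) = weil_ext \<iota> \<delta> \<omega> r (\<Phi> z)) \<and>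
     openin (top_of_set (carrier (HGSO \<iota> cj \<delta>)))
       {g \<in> carrier (HGSO \<iota> cj \<delta>). rtrans (HGSO \<iota> cj \<delta>) g \<Phi> = \<Phi>} \<and>
     (\<exists>C. compact C \<and> C \<subseteq> carrier (HGSO \<iota> cj \<delta>) \<and>
        (\<forall>z\<in>carrier (HGSO \<iota> cj \<delta>). \<Phi> z \<noteq> 0 \<longrightarrow>
           (\<exists>r\<in>RH_GSO \<iota> cj \<delta>. \<exists>k\<in>C. z = r \<otimes>\<^bsub>HGSO \<iota> cj \<delta>\<^esub> k)))}"

text \<open>The big theta lift of \<open>\<pi>\<close> is the space of \<open>H\<^sup>+(F)\<close>-coinvariants of the tensor product of
  \<open>Omega\<close> with the contragredient of \<open>\<pi>\<close>. It is presented as the vector space \<open>free_space\<close> on the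
  pure tensors modulo the span \<open>theta_rel\<close> of the bilinearity and invariance relations.\<close>

definition free_space :: "'x set \<Rightarrow> 'l set \<Rightarrow> ('x \<times> 'l \<Rightarrow> complex) set" where
  "free_space X D = {c. finite {p. c p \<noteq> 0} \<and> {p. c p \<noteq> 0} \<subseteq> X \<times> D}"

definition pure :: "'x \<Rightarrow> 'l \<Rightarrow> 'x \<times> 'l \<Rightarrow> complex" where
  "pure x l = (\<lambda>p. if p = (x, l) then 1 else 0)"

definition theta_rel ::
  "'h monoid \<Rightarrow> (complex \<Rightarrow> 'x::ab_group_add \<Rightarrow> 'x) \<Rightarrow> 'x set \<Rightarrow> ('h \<Rightarrow> 'x \<Rightarrow> 'x) \<Rightarrow>
   (complex \<Rightarrow> 'l::ab_group_add \<Rightarrow> 'l) \<Rightarrow> 'l set \<Rightarrow> ('h \<Rightarrow> 'l \<Rightarrow> 'l) \<Rightarrow> ('x \<times> 'l \<Rightarrow> complex) set" where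
  "theta_rel G scX X \<rho> scD D \<rho>' = module.span fscale
     ({pure (x + y) l - pure x l - pure y l | x y l. x \<in> X \<and> y \<in> X \<and> l \<in> D} \<union>
      {pure x (l + l') - pure x l - pure x l' | x l l'. x \<in> X \<and> l \<in> D \<and> l' \<in> D} \<union>
      {pure (scX c x) l - fscale c (pure x l) | c x l. x \<in> X \<and> l \<in> D} \<union>
      {pure x (scD c l) - fscale c (pure x l) | c x l. x \<in> X \<and> l \<in> D} \<union>
      {pure (\<rho> h x) (\<rho>' h l) - pure x l | h x l. h \<in> carrier G \<and> x \<in> X \<and> l \<in> D})"

definition semisimple_quotient ::
  "'g monoid \<Rightarrow> (complex \<Rightarrow> 'v::ab_group_add \<Rightarrow> 'v) \<Rightarrow> 'v set \<Rightarrow> ('g \<Rightarrow> 'v \<Rightarrow> 'v) \<Rightarrow> 'v set \<Rightarrow> bool" where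
  "semisimple_quotient G sc V \<rho> N \<longleftrightarrow> subrep G sc V \<rho> N \<and>
     (\<forall>M. subrep G sc V \<rho> M \<longrightarrow> N \<subseteq> M \<longrightarrow>
        (\<exists>M'. subrep G sc V \<rho> M' \<and> N \<subseteq> M' \<and> M \<inter> M' = N \<and> (\<forall>v\<in>V. \<exists>m\<in>M. \<exists>m'\<in>M'. v = m + m')))"

text \<open>\<open>V/N\<close> is the maximal semisimple quotient of \<open>V/R\<close>.\<close>

definition maximal_semisimple_quotient ::
  "'g monoid \<Rightarrow> (complex \<Rightarrow> 'v::ab_group_add \<Rightarrow> 'v) \<Rightarrow> 'v set \<Rightarrow> ('g \<Rightarrow> 'v \<Rightarrow> 'v) \<Rightarrow> 'v set \<Rightarrow> 'v set \<Rightarrow> bool" where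
  "maximal_semisimple_quotient G sc V \<rho> R N \<longleftrightarrow>
     R \<subseteq> N \<and> semisimple_quotient G sc V \<rho> N \<and>
     (\<forall>N'. R \<subseteq> N' \<longrightarrow> semisimple_quotient G sc V \<rho> N' \<longrightarrow> N \<subseteq> N')"

definition theta_action ::
  "('f::local_field \<Rightarrow> 'e::local_field) \<Rightarrow> ('e \<Rightarrow> 'e) \<Rightarrow> 'e \<Rightarrow> 'f^6^6 \<Rightarrow>
   ((('f^4^4) \<times> ('f^6^6) \<Rightarrow> 'f schwartz) \<times> 'l \<Rightarrow> complex) \<Rightarrow>
   ((('f^4^4) \<times> ('f^6^6) \<Rightarrow> 'f schwartz) \<times> 'l \<Rightarrow> complex)" where
  "theta_action \<iota> cj \<delta> T c = (\<lambda>(\<Phi>, l). if \<forall>z. z \<notin> carrier (HGSO \<iota> cj \<delta>) \<longrightarrow> \<Phi> z = 0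
     then c (rtrans (HGSO \<iota> cj \<delta>) (mat 1, inv\<^bsub>matrix_group (GSO \<iota> \<delta>)\<^esub> T) \<Phi>, l) else 0)"

text \<open>\<open>\<Pi>\<^sub>G\<close>, a representation of \<open>PG(F)\<close>, is the small theta lift of the representation \<open>\<pi>\<close> of
  \<open>H\<^sup>+(F)\<close>.\<close>

definition small_theta_lift ::
  "('f::local_field \<Rightarrow> 'e::local_field) \<Rightarrow> ('e \<Rightarrow> 'e) \<Rightarrow> 'e \<Rightarrow> ('f \<Rightarrow> complex) \<Rightarrow>
   (complex \<Rightarrow> 'w::ab_group_add \<Rightarrow> 'w) \<Rightarrow> ('f^4^4 \<Rightarrow> 'w \<Rightarrow> 'w) \<Rightarrow>
   (complex \<Rightarrow> 'v::ab_group_add \<Rightarrow> 'v) \<Rightarrow> ('e^4^4 \<Rightarrow> 'v \<Rightarrow> 'v) \<Rightarrow> bool" where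
  "small_theta_lift \<iota> cj \<delta> \<psi> sc \<pi> sc' \<Pi>\<^sub>G \<longleftrightarrow>
     (\<exists>\<omega> A. weil_rep \<iota> cj \<delta> \<psi> \<omega> \<and>
       (let H = matrix_group (GSp4_plus \<iota> cj);
            X = Omega \<iota> cj \<delta> \<omega>;
            D = smooth_dual H sc \<pi>;
            V = free_space X D;
            R = theta_rel H fscale2 X (\<lambda>h. rtrans (HGSO \<iota> cj \<delta>) (h, mat 1)) fscale D (dual_action H \<pi>)
        in linear_on fscale V sc' A \<and> A ` V = UNIV \<and>
           (\<forall>g T. PG_PGSO \<iota> cj \<delta> g T \<longrightarrow>
              (\<forall>c\<in>V. A (theta_action \<iota> cj \<delta> T c) = \<Pi>\<^sub>G g (A c))) \<and>
           maximal_semisimple_quotient (matrix_group (GSO \<iota> \<delta>)) fscale V (theta_action \<iota> cj \<delta>) R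
             {c \<in> V. A c = 0}))"


section \<open>The Shalika functional\<close>

definition shalika_functional ::
  "('f::local_field \<Rightarrow> 'e::local_field) \<Rightarrow> ('e \<Rightarrow> 'e) \<Rightarrow> 'e \<Rightarrow> ('f \<Rightarrow> complex) \<Rightarrow>
   (complex \<Rightarrow> 'v::ab_group_add \<Rightarrow> 'v) \<Rightarrow> ('e^4^4 \<Rightarrow> 'v \<Rightarrow> 'v) \<Rightarrow> ('v \<Rightarrow> complex) \<Rightarrow> bool" where
  "shalika_functional \<iota> cj \<delta> \<psi> sc \<Pi>\<^sub>G \<Lambda> \<longleftrightarrow>
     linear_on sc UNIV (*) \<Lambda> \<and> (\<exists>v. \<Lambda> v \<noteq> 0) \<and>
     (\<forall>h a x y v. invertible h \<longrightarrow>
        \<Lambda> (\<Pi>\<^sub>G (map_matrix \<iota> (hstar h) ** siegel_unip a (\<iota> x) (\<iota> y) (cj a)) v)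
          = \<psi> (toF \<iota> (\<delta> * a - \<delta> * cj a)) * \<Lambda> v)"

text \<open>The character \<open>a \<mapsto> \<psi>(\<delta> a - \<delta> cj(a))\<close> of \<open>E\<close> has conductor the ring of integers of \<open>E\<close>; this is
  the case when \<open>\<psi>\<close> is unramified and \<open>\<delta>\<close> is a unit.\<close>

definition shalika_character_unramified ::
  "('f::local_field \<Rightarrow> 'e::local_field) \<Rightarrow> ('e \<Rightarrow> 'e) \<Rightarrow> 'e \<Rightarrow> ('f \<Rightarrow> complex) \<Rightarrow> bool" where
  "shalika_character_unramified \<iota> cj \<delta> \<psi> \<longleftrightarrow>
     (\<forall>a. absv a \<le> 1 \<longrightarrow> \<psi> (toF \<iota> (\<delta> * a - \<delta> * cj a)) = 1) \<and>
     (\<forall>p. uniformizer p \<longrightarrow> (\<exists>a. absv (p * a) \<le> 1 \<and> \<psi> (toF \<iota> (\<delta> * a - \<delta> * cj a)) \<noteq> 1))"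

text \<open>The Laurent polynomials \<open>e\<^sup>(\<^sup>a\<^sup>,\<^sup>b\<^sup>)\<close> as elements of the group algebra of \<open>\<int>\<^sup>2\<close>.\<close>

type_synonym laurent = "(int^2) \<Rightarrow>\<^sub>0 complex"

definition ex :: "int \<Rightarrow> int \<Rightarrow> laurent" where
  "ex a b = Poly_Mapping.single (\<chi> i. if i = 1 then a else b) 1"

definition const_laurent :: "complex \<Rightarrow> laurent" where
  "const_laurent c = Poly_Mapping.single 0 c"

definition signed_perms :: "(int^2^2) set" where
  "signed_perms = {w. (\<forall>i. \<exists>!j. w$i$j \<noteq> 0) \<and> (\<forall>j. \<exists>!i. w$i$j \<noteq> 0) \<and> (\<forall>i j. w$i$j \<in> {-1, 0, 1})}"

definition alt_sum :: "laurent \<Rightarrow> laurent" where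
  "alt_sum f = (\<Sum>w\<in>signed_perms. \<Sum>k\<in>Poly_Mapping.keys f.
      Poly_Mapping.single (w *v k) (of_int (det w) * Poly_Mapping.lookup f k))"

definition laurent_eval :: "complex \<Rightarrow> complex \<Rightarrow> laurent \<Rightarrow> complex" where
  "laurent_eval t1 t2 f = (\<Sum>k\<in>Poly_Mapping.keys f. Poly_Mapping.lookup f k * t1 powi (k$1) * t2 powi (k$2))"

text \<open>The quotient by the Weyl denominator is formed in the Laurent polynomial ring and evaluated
  afterwards, so that it makes sense at singular Satake parameters too.\<close>

definition weyl_quotient :: "laurent \<Rightarrow> laurent" where
  "weyl_quotient f = (THE P. P * alt_sum (ex 2 1) = alt_sum f)"

text \<open>The value at the identity is \<open>1\<close>: the alternating sum for \<open>n = 0\<close> is \<open>1 - q\<^sup>-\<^sup>1\<close> times the Weyl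
  denominator, because \<open>alt_sum (ex 1 2) = - alt_sum (ex 2 1)\<close> and the other two terms vanish.
  This value is forced by the identity of the integral with the \<open>L\<close>-function, both sides of
  which have to tend to \<open>1\<close> for \<open>s \<rightarrow> \<infinity>\<close>; hence the factor \<open>1 - q\<^sup>-\<^sup>1\<close> in the denominator.\<close>

definition shalika_value :: "nat \<Rightarrow> complex \<Rightarrow> complex \<Rightarrow> nat \<Rightarrow> complex" where
  "shalika_value q t1 t2 n =
     (1 / of_nat q) ^ (2 * n) / (1 - 1 / of_nat q) *
     laurent_eval t1 t2 (weyl_quotient
       (const_laurent ((-1) ^ n) * ex (2 + int n) (1 + int n)
         * (1 + const_laurent (1 / of_nat q) * ex (-1) (-1))
         * (1 + const_laurent (1 / of_nat q) * ex (-1) 1)))"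


section \<open>The zeta integral\<close>

definition section_space :: "complex \<Rightarrow> ('f::local_field^4^4 \<Rightarrow> complex) set" where
  "section_space s = smooth_ind (matrix_group GSp4) PH (\<lambda>p. of_real (delta_PH p) powr ((s + 1) / 3))"

text \<open>The invariant measure on the space of right cosets of \<open>GL\<^sub>2(F) N(F)\<close> in \<open>GSp\<^sub>4(F)\<close>, normalized by
  \<open>\<integral> \<Phi> = \<integral>\<integral> \<delta>\<^sup>-\<^sup>1(m(\<mu>)) \<Phi>(m(\<mu>) k) dk d\<^sup>\<times>\<mu>\<close>, where both inner measures have total mass one on the maximal
  compact subgroup.\<close>

definition quotient_measure :: "('f::local_field^4^4) set measure \<Rightarrow> bool" where
  "quotient_measure dh \<longleftrightarrow>
     (let G = matrix_group GSp4 in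
       space dh = rcosets\<^bsub>G\<^esub> GL2_NH \<and>
       sets dh = {A. A \<subseteq> rcosets\<^bsub>G\<^esub> GL2_NH \<and> \<Union>A \<in> sets borel} \<and>
       (\<forall>h\<in>carrier G. \<forall>A\<in>sets dh. emeasure dh ((\<lambda>C. C #>\<^bsub>G\<^esub> h) ` A) = emeasure dh A) \<and>
       (\<exists>dk dm. haar_measure (matrix_group GSp4_O) dk \<and> emeasure dk GSp4_O = 1 \<and>
          haar_measure unit_group dm \<and> emeasure dm {x. absv x = 1} = 1 \<and>
          (\<forall>\<Phi>\<in>borel_measurable dh.
             (\<integral>\<^sup>+C. \<Phi> C \<partial>dh) =
             (\<integral>\<^sup>+u. ennreal (inverse (delta_PH (m_mu u))) *
                (\<integral>\<^sup>+k. \<Phi> (GL2_NH #>\<^bsub>G\<^esub> (m_mu u ** k)) \<partial>dk) \<partial>dm))))"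

text \<open>Value on a coset of a function which is constant on it.\<close>

definition on_coset :: "('g \<Rightarrow> complex) \<Rightarrow> 'g set \<Rightarrow> complex" where
  "on_coset \<Phi> C = \<Phi> (SOME h. h \<in> C)"

definition std_weights :: "complex \<Rightarrow> complex \<Rightarrow> complex list" where
  "std_weights t1 t2 = [t1 * t2, t1 / t2, 1, t2 / t1, 1 / (t1 * t2)]"

text \<open>The twist by the quadratic character of \<open>E/F\<close> accounts for the sign.\<close>

definition L_std_twisted :: "nat \<Rightarrow> complex \<Rightarrow> complex \<Rightarrow> complex \<Rightarrow> complex" where
  "L_std_twisted q t1 t2 s =
     (\<Prod>w\<leftarrow>std_weights t1 t2. inverse (1 + w * of_nat q powr (- s)))"

end

theory Submission
  imports Defs
begin

text \<open>The integrand is left invariant under \<open>GL\<^sub>2 N\<close>, and its value at \<open>m(\<mu>) k\<close> depends only on the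
  integer \<open>n\<close> with \<open>\<bar>\<mu>\<bar> = q\<^sup>n\<close>. It vanishes for \<open>n < 0\<close>, by moving integral unipotent elements across
  \<open>diag(z, z, 1, 1)\<close>. The integral is therefore \<open>\<zeta>(s + 1) \<zeta>(2 s)\<close> times a power series in \<open>X = q\<^sup>-\<^sup>s\<close> with
  coefficients \<open>(-1)\<^sup>n (\<chi>\<^sub>n + q\<^sup>-\<^sup>1 \<chi>\<^sub>n\<^sub>-\<^sub>1)\<close>, where \<open>\<chi>\<^sub>n\<close> is the character of \<open>Sp\<^sub>4\<close> with highest weight \<open>(n, n)\<close>.
  The Weyl numerators of the \<open>\<chi>\<^sub>n\<close> satisfy a linear recurrence whose characteristic roots are the four
  nonzero weights of the five-dimensional representation, whence
  \<open>\<Sum> \<chi>\<^sub>n Y\<^sup>n = (1 - Y\<^sup>2) / \<Prod> (1 - \<lambda> Y)\<close> over all five weights \<open>\<lambda>\<close>. For \<open>Y = - X\<close> the factor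
  \<open>(1 + q\<^sup>-\<^sup>1 Y) (1 - Y\<^sup>2)\<close> cancels the zeta values.\<close>

section \<open>Local fields\<close>

text \<open>At |u| = q^n three powers of q meet: the inverse modulus contributes q^(3n), the section
  q^(-n(s+1)) and the prescribed Shalika value q^(-2n), so exactly X^n survives. Three obstacles
  shape the proof. The Weyl denominator may vanish at the Satake parameter; division by it takes
  place in the Laurent ring, where it can be cancelled, and the quotient is identified there before
  it is evaluated. The quotient measure is characterized by integrals of nonnegative functions only;
  the complex integral is reached by comparing image measures on the complex plane. Finally, the
  absolute values of E and F are compared only on the image of F. That conjugation preserves
  \<open>absv\<close>, without which an integral \<open>a\<close> need not give an integral
  unipotent matrix, has to be derived from the completeness of F.\<close>

lemma absv_nonneg: "absv (x :: 'a::local_field) \<ge> 0"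
  using zero_le_dist[of x 0] by (simp add: dist_absv)

lemma absv_eq_0_iff: "absv (x :: 'a::local_field) = 0 \<longleftrightarrow> x = 0"
  using dist_eq_0_iff[of x 0] by (simp add: dist_absv)

lemma absv_0: "absv (0 :: 'a::local_field) = 0"
  by (simp add: absv_eq_0_iff)

lemma absv_1: "absv (1 :: 'a::local_field) = 1"
  using absv_mult[of "1::'a" 1] absv_eq_0_iff[of "1::'a"] by simp

lemma absv_minus: "absv (- x :: 'a::local_field) = absv x"
  using dist_commute[of x 0] by (simp add: dist_absv)

lemma absv_diff: "absv (x - y :: 'a::local_field) \<le> max (absv x) (absv y)"
  using absv_ultrametric[of x "- y"] by (simp add: absv_minus)

lemma absv_inverse: "absv (inverse x :: 'a::local_field) = inverse (absv x)"
proof (cases "x = 0")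
  case False
  then have "absv x * absv (inverse x) = 1"
    by (simp flip: absv_mult add: absv_1)
  then show ?thesis by (metis inverse_unique)
qed (simp add: absv_0)

lemma absv_divide: "absv (x / y :: 'a::local_field) = absv x / absv y"
  by (simp add: divide_inverse absv_mult absv_inverse)

lemma absv_power: "absv (x ^ n :: 'a::local_field) = absv x ^ n"
  by (induction n) (simp_all add: absv_1 absv_mult)

lemma absv_power_int: "absv (x powi n :: 'a::local_field) = absv x powi n"
  by (simp add: power_int_def absv_power absv_inverse)

lemma absv_add_eq_max:
  fixes x y :: "'a::local_field"
  assumes "absv x < absv y"
  shows "absv (x + y) = absv y"
proof (rule antisym)
  show "absv (x + y) \<le> absv y"
    using absv_ultrametric[of x y] assms by simp
  show "absv y \<le> absv (x + y)"
    using absv_diff[of "x + y" x] assms by simp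
qed

lemma resq_gt_1: "resq TYPE('a::local_field) > 1"
proof -
  let ?r = "{(x, y :: 'a). absv x \<le> 1 \<and> absv y \<le> 1 \<and> absv (x - y) < 1}"
  let ?Q = "{x :: 'a. absv x \<le> 1} // ?r"
  have "?r `` {0} \<in> ?Q" "?r `` {1} \<in> ?Q"
    by (rule quotientI, simp add: absv_0 absv_1)+
  moreover have "?r `` {0} \<noteq> ?r `` {1}"
  proof -
    have "0 \<in> ?r `` {0}" "0 \<notin> ?r `` {1}" by (auto simp: absv_0 absv_1)
    then show ?thesis by blast
  qed
  ultimately have "2 \<le> card ?Q"
    using card_mono[OF finite_residue_classes, of "{?r `` {0}, ?r `` {1}}"] by simp
  then show ?thesis by (simp add: resq_def)
qed

lemma uniformizer_exists: "\<exists>p :: 'a::local_field. uniformizer p"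
proof -
  obtain p :: 'a where p: "p \<noteq> 0" "absv p = 1 / real (resq TYPE('a))"
    "\<And>x :: 'a. absv x < 1 \<Longrightarrow> absv x \<le> absv p"
    using ex_uniformizer[where 'a = 'a, folded resq_def[of "TYPE('a)"]] by blast
  then have "uniformizer p"
    using resq_gt_1[where 'a = 'a] by (simp add: uniformizer_def)
  then show ?thesis ..
qed

text \<open>The class supplies one element of value 1/q that is maximal below 1, and
  \<open>uniformizer\<close> asks for maximality; two maximal elements have the same value.\<close>

lemma absv_uniformizer:
  assumes "uniformizer (p :: 'a::local_field)"
  shows "absv p = 1 / real (resq TYPE('a))"
proof -
  obtain p0 :: 'a where p0: "p0 \<noteq> 0" "absv p0 = 1 / real (resq TYPE('a))"
    "\<And>x :: 'a. absv x < 1 \<Longrightarrow> absv x \<le> absv p0"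
    using ex_uniformizer[where 'a = 'a, folded resq_def[of "TYPE('a)"]] by blast
  have "absv p0 < 1" using p0(2) resq_gt_1[where 'a = 'a] by simp
  then show ?thesis using assms p0 unfolding uniformizer_def by (metis antisym)
qed

lemma absv_eq_power:
  fixes p x :: "'a::local_field"
  assumes "uniformizer p" "x \<noteq> 0"
  obtains n where "absv x = absv p powi n"
proof -
  have p: "p \<noteq> 0" "absv p < 1" "absv p > 0"
    using assms absv_nonneg[of p] absv_eq_0_iff[of p] by (auto simp: uniformizer_def)
  have x: "absv x > 0" using assms absv_nonneg[of x] absv_eq_0_iff[of x] by linarith
  \<comment> \<open>The floor makes \<open>n\<close> the largest exponent with |x| <= |p|^n. Then x
    / p^n has value in (|p|, 1], and the maximality of |p| below 1 leaves only the value 1.\<close>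
  define n where "n = \<lfloor>ln (absv x) / ln (absv p)\<rfloor>"
  have l: "ln (absv p) < 0" using p by simp
  have "of_int n \<le> ln (absv x) / ln (absv p)" "ln (absv x) / ln (absv p) < of_int n + 1"
    unfolding n_def by linarith+
  then have "of_int n * ln (absv p) \<ge> ln (absv x)" "ln (absv x) > (of_int n + 1) * ln (absv p)"
    using l by (simp_all add: field_simps)
  moreover have "ln (absv p powi m) = of_int m * ln (absv p)" for m
    using p ln_powr[of "absv p" "of_int m"] powr_real_of_int'[of "absv p" m] by simp
  ultimately have "ln (absv x) \<le> ln (absv p powi n)" "ln (absv p powi (n + 1)) < ln (absv x)"
    by simp_all
  then have b: "absv x \<le> absv p powi n" "absv p powi n * absv p < absv x"
    using p x by (simp_all add: power_int_add)
  define y where "y = x / p powi n"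
  have "absv p powi n > 0" using p by simp
  moreover have "absv y = absv x / absv p powi n"
    by (simp add: y_def absv_divide absv_power_int)
  ultimately have "absv y \<le> 1" "absv y > absv p"
    using b by (simp_all add: pos_divide_le_eq pos_less_divide_eq mult.commute)
  moreover have "\<not> absv y < 1"
    using assms(1) \<open>absv y > absv p\<close> unfolding uniformizer_def by (meson not_less)
  ultimately have "absv y = 1" by simp
  with \<open>absv y = absv x / absv p powi n\<close> \<open>absv p powi n > 0\<close> show thesis
    by (intro that[of n]) simp
qed

section \<open>Continuity of the ring operations\<close>

instance local_field \<subseteq> topological_ab_group_add
proof
  fix a b :: 'a
  show "((\<lambda>x. fst x + snd x) \<longlongrightarrow> a + b) (nhds a \<times>\<^sub>F nhds b)"
  proof (rule tendstoI)
    fix e :: real assume "e > 0"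
    then have "\<forall>\<^sub>F x in nhds a. dist x a < e" "\<forall>\<^sub>F x in nhds b. dist x b < e"
      by (auto simp: eventually_nhds_metric)
    then have "\<forall>\<^sub>F x in nhds a \<times>\<^sub>F nhds b. dist (fst x) a < e \<and> dist (snd x) b < e"
      by (auto simp: eventually_prod_filter)
    then show "\<forall>\<^sub>F x in nhds a \<times>\<^sub>F nhds b. dist (fst x + snd x) (a + b) < e"
    proof eventually_elim
      case (elim x)
      have "dist (fst x + snd x) (a + b) \<le> max (dist (fst x) a) (dist (snd x) b)"
        using absv_ultrametric[of "fst x - a" "snd x - b"] by (simp add: dist_absv algebra_simps)
      then show ?case using elim by linarith
    qed
  qed
  show "(uminus \<longlongrightarrow> - a) (nhds a)"
  proof (rule tendstoI)
    fix e :: real assume "e > 0"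
    then have "\<forall>\<^sub>F x in nhds a. dist x a < e"
      by (auto simp: eventually_nhds_metric)
    then show "\<forall>\<^sub>F x in nhds a. dist (- x) (- a) < e"
    proof eventually_elim
      case (elim x)
      then show ?case using absv_minus[of "x - a"] by (simp add: dist_absv)
    qed
  qed
qed

instance local_field \<subseteq> topological_semigroup_mult
proof
  fix a b :: 'a
  show "((\<lambda>x. fst x * snd x) \<longlongrightarrow> a * b) (nhds a \<times>\<^sub>F nhds b)"
  proof (rule tendstoI)
    fix e :: real assume e: "e > 0"
    \<comment> \<open>\<open>C\<close> bounds |b| as well as |a + x| for |x| < d <= 1, so both terms
      of the increment x b + (a + x) y stay below C d <= e.\<close>
    define C where "C = absv a + absv b + 1"
    have C: "C \<ge> 1" using absv_nonneg[of a] absv_nonneg[of b] by (simp add: C_def)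
    define d where "d = min 1 (e / C)"
    have d: "d > 0" "d \<le> 1" "C * d \<le> e" using e C by (auto simp: d_def min_def field_simps)
    then have "\<forall>\<^sub>F x in nhds a. dist x a < d" "\<forall>\<^sub>F x in nhds b. dist x b < d"
      by (auto simp: eventually_nhds_metric)
    then have "\<forall>\<^sub>F x in nhds a \<times>\<^sub>F nhds b. dist (fst x) a < d \<and> dist (snd x) b < d"
      by (auto simp: eventually_prod_filter)
    then show "\<forall>\<^sub>F x in nhds a \<times>\<^sub>F nhds b. dist (fst x * snd x) (a * b) < e"
    proof eventually_elim
      case (elim z)
      define x y where "x = fst z - a" and "y = snd z - b"
      have xy: "absv x < d" "absv y < d" using elim by (auto simp: dist_absv x_def y_def)
      have "absv (a + x) \<le> C"
        using absv_ultrametric[of a x] xy d absv_nonneg[of a] absv_nonneg[of b] by (simp add: C_def)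
      then have "absv (a + x) * absv y \<le> C * absv y"
        using absv_nonneg[of y] by (intro mult_right_mono)
      also have "\<dots> < C * d" using xy C by simp
      finally have "absv (a + x) * absv y < C * d" .
      moreover have "absv b < C" using absv_nonneg[of a] by (simp add: C_def)
      then have "absv x * absv b < d * C"
        using xy absv_nonneg[of x] absv_nonneg[of b] by (intro mult_strict_mono') auto
      ultimately have m: "max (absv (x * b)) (absv ((a + x) * y)) < e"
        using d by (simp add: absv_mult mult.commute)
      have "fst z * snd z - a * b = x * b + (a + x) * y"
        by (simp add: x_def y_def algebra_simps)
      then show ?case
        using m absv_ultrametric[of "x * b" "(a + x) * y"] by (simp add: dist_absv del: max_less_iff_conj)
    qed
  qed
qed

lemma absv_eq_imp_nhds:
  fixes x y :: "'a::local_field"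
  assumes "absv (y - x) < absv x"
  shows "absv y = absv x"
  using absv_add_eq_max[OF assms] by simp

lemma open_absv_eq:
  assumes "c \<noteq> 0"
  shows "open {x :: 'a::local_field. absv x = c}"
  unfolding open_contains_ball
proof
  fix x :: 'a assume x: "x \<in> {x. absv x = c}"
  then have "absv x > 0" using assms absv_nonneg[of x] by auto
  moreover have "ball x (absv x) \<subseteq> {x. absv x = c}"
  proof (rule subsetI)
    fix y :: 'a assume "y \<in> ball x (absv x)"
    then have "absv (y - x) < absv x" using absv_minus[of "y - x"] by (simp add: dist_absv)
    from absv_eq_imp_nhds[OF this] x show "y \<in> {x. absv x = c}" by simp
  qed
  ultimately show "\<exists>e>0. ball x e \<subseteq> {x. absv x = c}" by blast
qed

subsection \<open>Unramified quadratic extensions\<close>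

context unramified_quadratic_ext
begin

lemma \<iota>_0: "\<iota> 0 = 0"
  using \<iota>_add[of 0 0] by simp

lemma \<iota>_minus: "\<iota> (- x) = - \<iota> x"
  using \<iota>_add[of x "- x"] by (simp add: \<iota>_0 eq_neg_iff_add_eq_0 add.commute)

lemma \<iota>_diff: "\<iota> (x - y) = \<iota> x - \<iota> y"
  using \<iota>_add[of x "- y"] by (simp add: \<iota>_minus)

lemma \<iota>_eq_0_iff: "\<iota> x = 0 \<longleftrightarrow> x = 0"
  using absv_\<iota>[of x] absv_eq_0_iff[of "\<iota> x"] absv_eq_0_iff[of x] by simp

lemma \<iota>_eq_iff: "\<iota> x = \<iota> y \<longleftrightarrow> x = y"
  using \<iota>_eq_0_iff[of "x - y"] by (simp add: \<iota>_diff)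

lemma toF_\<iota>: "toF \<iota> (\<iota> x) = x"
  unfolding toF_def by (rule inv_into_f_f) (auto intro: injI simp: \<iota>_eq_iff)

lemma \<iota>_inverse: "\<iota> (inverse x) = inverse (\<iota> x)"
proof (cases "x = 0")
  case False
  then have "\<iota> x * \<iota> (inverse x) = 1" by (simp add: \<iota>_one flip: \<iota>_mult)
  then show ?thesis by (metis inverse_unique)
qed (simp add: \<iota>_0)

lemma \<iota>_divide: "\<iota> (x / y) = \<iota> x / \<iota> y"
  by (simp add: divide_inverse \<iota>_mult \<iota>_inverse)

lemma \<iota>_power: "\<iota> (x ^ n) = \<iota> x ^ n"
  by (induction n) (simp_all add: \<iota>_one \<iota>_mult)

lemma continuous_\<iota>: "continuous_on A \<iota>"
  unfolding continuous_on_iff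
proof (intro ballI allI impI)
  fix x and e :: real assume "e > 0"
  have "dist (\<iota> y) (\<iota> x) < e" if "dist y x < sqrt e" for y
  proof -
    have "(dist y x)\<^sup>2 < (sqrt e)\<^sup>2" using that by (intro power_strict_mono) auto
    then show ?thesis using \<open>e > 0\<close> by (simp add: dist_absv absv_\<iota> flip: \<iota>_diff)
  qed
  then show "\<exists>d>0. \<forall>y\<in>A. dist y x < d \<longrightarrow> dist (\<iota> y) (\<iota> x) < e"
    using \<open>e > 0\<close> by (intro exI[of _ "sqrt e"]) auto
qed

lemma cj_0: "cj 0 = 0"
  using cj_add[of 0 0] by simp

lemma cj_minus: "cj (- u) = - cj u"
  using cj_add[of u "- u"] by (simp add: cj_0 eq_neg_iff_add_eq_0 add.commute)

lemma cj_cj: "cj (cj u) = u"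
proof -
  obtain x y where "u = \<iota> x + \<iota> y * \<delta>" using generated by blast
  then show ?thesis by (simp add: cj_add cj_mult cj_\<iota> cj_\<delta> cj_minus diff_conv_add_uminus del: add_uminus_conv_diff)
qed

lemma cj_one: "cj 1 = 1"
  using cj_\<iota>[of 1] by (simp add: \<iota>_one)

lemma cj_power: "cj (u ^ n) = cj u ^ n"
  by (induction n) (simp_all add: cj_one cj_mult)

text \<open>The component along \<delta> equals its own negative, and the characteristic is
  zero.\<close>

lemma fixed_imp_in_range:
  assumes "cj u = u"
  shows "u \<in> range \<iota>"
proof -
  obtain x y where u: "u = \<iota> x + \<iota> y * \<delta>" using generated by blast
  with assms have "\<iota> y * \<delta> = - (\<iota> y * \<delta>)"
    by (simp add: cj_add cj_mult cj_\<iota> cj_\<delta>)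
  then have "\<iota> y * \<delta> = 0" by (metis eq_neg_iff_add_eq_0 mult_2 mult_eq_0_iff zero_neq_numeral)
  then show ?thesis using u by (simp only: add_0_right rangeI)
qed

text \<open>If \<open>\<bar>b\<bar> < \<bar>c\<bar>\<close> for \<open>c = cj b\<close>, the quotients \<open>(b\<^sup>n\<^sup>+\<^sup>1 + c\<^sup>n\<^sup>+\<^sup>1) / (b\<^sup>n + c\<^sup>n)\<close> lie in the complete field \<open>F\<close> and
  converge to \<open>c\<close>, so that \<open>c \<in> F\<close>.\<close>

lemma absv_not_less_cj:
  assumes "absv b < absv (cj b)"
  shows False
proof -
  define c where "c = cj b"
  define r where "r = absv b / absv c"
  have c: "absv c > 0" "c \<noteq> 0" and r: "0 \<le> r" "r < 1"
    using assms absv_nonneg[of b] absv_nonneg[of "cj b"] by (auto simp: c_def r_def absv_0)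
  \<comment> \<open>The exponents start at 1, since at exponent 0 both sides would be 1. Strictness
    gives the sum of the two powers the value of its dominant term, so the denominators below are
    nonzero.\<close>
  have pow: "absv (b ^ Suc n) < absv (c ^ Suc n)" for n
    using assms absv_nonneg[of b] unfolding absv_power c_def by (intro power_strict_mono) auto
  have T: "absv (b ^ Suc n + c ^ Suc n) = absv c ^ Suc n" for n
    using absv_add_eq_max[OF pow[of n]] by (simp only: absv_power)
  have "\<exists>\<tau>. b ^ Suc n + c ^ Suc n = \<iota> \<tau>" for n
    using fixed_imp_in_range[of "b ^ Suc n + c ^ Suc n"]
    by (auto simp: cj_add cj_power cj_mult c_def cj_cj add.commute)
  then obtain \<tau> where \<tau>: "\<And>n. b ^ Suc n + c ^ Suc n = \<iota> (\<tau> n)" by metis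
  define a where "a n = \<tau> (Suc n) / \<tau> n" for n
  have conv: "absv (\<iota> (a n) - c) = r ^ Suc n * absv (b - c)" for n
  proof -
    have nz: "b ^ Suc n + c ^ Suc n \<noteq> 0" using T[of n] c absv_0 by (metis less_irrefl power_eq_0_iff)
    have "\<iota> (a n) - c = (b ^ Suc (Suc n) + c ^ Suc (Suc n)) / (b ^ Suc n + c ^ Suc n) - c"
      by (simp only: a_def \<iota>_divide \<tau>)
    also have "\<dots> = b ^ Suc n * (b - c) / (b ^ Suc n + c ^ Suc n)"
      using nz by (simp add: field_simps)
    finally show ?thesis
      by (simp only: absv_mult absv_divide T absv_power r_def power_divide) simp
  qed
  have lim: "(\<lambda>n. \<iota> (a n)) \<longlonglongrightarrow> c"
  proof (rule metric_tendsto_imp_tendsto)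
    have "(\<lambda>n. r ^ Suc n * absv (b - c)) \<longlonglongrightarrow> 0 * absv (b - c)"
      using r by (intro tendsto_intros LIMSEQ_Suc LIMSEQ_realpow_zero)
    then show "(\<lambda>n. r ^ Suc n * absv (b - c)) \<longlonglongrightarrow> 0" by simp
    show "\<forall>\<^sub>F n in sequentially. dist (\<iota> (a n)) c \<le> dist (r ^ Suc n * absv (b - c)) 0"
      using r absv_nonneg[of "b - c"] by (simp add: dist_absv conv)
  qed
  have "Cauchy a"
  proof (rule metric_CauchyI)
    fix e :: real assume "e > 0"
    \<comment> \<open>The inclusion squares absolute values, so distance below e in F means distance
      below e^2 in E.\<close>
    then have "e\<^sup>2 > 0" by simp
    then obtain M where M: "\<And>m n. m \<ge> M \<Longrightarrow> n \<ge> M \<Longrightarrow> dist (\<iota> (a m)) (\<iota> (a n)) < e\<^sup>2"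
      using LIMSEQ_imp_Cauchy[OF lim] unfolding Cauchy_def by blast
    have "dist (a m) (a n) < e" if "m \<ge> M" "n \<ge> M" for m n
      using M[OF that] \<open>e > 0\<close> by (auto simp: dist_absv absv_\<iota> simp flip: \<iota>_diff intro: power_less_imp_less_base[of _ 2])
    then show "\<exists>M. \<forall>m\<ge>M. \<forall>n\<ge>M. dist (a m) (a n) < e" by blast
  qed
  then obtain l where "a \<longlonglongrightarrow> l"
    using Cauchy_convergent convergent_def by blast
  then have "(\<lambda>n. \<iota> (a n)) \<longlonglongrightarrow> \<iota> l"
    by (rule continuous_on_tendsto_compose[OF continuous_\<iota>[of UNIV]]) auto
  then have "c = \<iota> l" using lim LIMSEQ_unique by blast
  then have "b = c" using cj_\<iota> cj_cj c_def by metis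
  then show False using assms by (simp add: c_def)
qed

text \<open>Conjugation is an involution, so a strict inequality in either direction is excluded.
  This makes \<open>siegel_unip a 0 0 (cj a)\<close> integral as soon as \<open>a\<close>
  is.\<close>

lemma absv_cj: "absv (cj u) = absv u"
  by (metis absv_not_less_cj cj_cj linorder_neqE)

end

section \<open>Similitude groups\<close>

lemma pos4_simps [simp]: "pos4 1 = 0" "pos4 2 = 1" "pos4 3 = 2" "pos4 4 = 3"
  by (simp_all add: pos4_def)

lemma block_nth:
  "block A B C D $ 1 $ 1 = A$1$1" "block A B C D $ 1 $ 2 = A$1$2" "block A B C D $ 1 $ 3 = B$1$1" "block A B C D $ 1 $ 4 = B$1$2"
  "block A B C D $ 2 $ 1 = A$2$1" "block A B C D $ 2 $ 2 = A$2$2" "block A B C D $ 2 $ 3 = B$2$1" "block A B C D $ 2 $ 4 = B$2$2"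
  "block A B C D $ 3 $ 1 = C$1$1" "block A B C D $ 3 $ 2 = C$1$2" "block A B C D $ 3 $ 3 = D$1$1" "block A B C D $ 3 $ 4 = D$1$2"
  "block A B C D $ 4 $ 1 = C$2$1" "block A B C D $ 4 $ 2 = C$2$2" "block A B C D $ 4 $ 3 = D$2$1" "block A B C D $ 4 $ 4 = D$2$2"
  by (simp_all add: block_def mat4_def numeral_eq_Suc)

lemma mat2_nth:
  "mat2 a b c d $ 1 $ 1 = a" "mat2 a b c d $ 1 $ 2 = b" "mat2 a b c d $ 2 $ 1 = c" "mat2 a b c d $ 2 $ 2 = d"
  by (simp_all add: mat2_def)

lemma mat2_collapse: "mat2 (A$1$1) (A$1$2) (A$2$1) (A$2$2) = A"
  by (simp add: vec_eq_iff forall_2 mat2_nth)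

lemma mat_mult_nth: "(mat c ** A) $ i $ j = c * A$i$j" for A :: "'a::semiring_1^'m^'n"
  by (simp add: matrix_matrix_mult_def mat_def if_distrib[of "\<lambda>x. x * _"] cong: if_cong)

lemma mat_mult_mat: "mat a ** mat b = mat (a * b)" for a b :: "'a::semiring_1"
  by (simp add: vec_eq_iff mat_mult_nth) (simp add: mat_def)

lemma mat_commute: "A ** mat c = mat c ** A" for A :: "'a::comm_semiring_1^'n^'n"
  by (simp add: vec_eq_iff mat_mult_nth)
     (simp add: matrix_matrix_mult_def mat_def if_distrib[of "\<lambda>x. _ * x"] mult.commute cong: if_cong)

lemma map_matrix_id: "map_matrix (\<lambda>x. x) A = A"
  by (simp add: vec_eq_iff)

lemma transpose_map_matrix: "transpose (map_matrix f A) = map_matrix f (transpose A)"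
  by (simp add: vec_eq_iff transpose_def)

lemma map_matrix_block: "map_matrix f (block A B C D) = block (map_matrix f A) (map_matrix f B) (map_matrix f C) (map_matrix f D)"
  by (simp add: vec_eq_iff forall_4 block_nth)

lemma map_matrix_mult:
  fixes A :: "'a::semiring_1^'m^'n" and f :: "'a \<Rightarrow> 'b::semiring_1"
  assumes "f 0 = 0" "\<And>x y. f (x + y) = f x + f y" "\<And>x y. f (x * y) = f x * f y"
  shows "map_matrix f (A ** B) = map_matrix f A ** map_matrix f B"
proof -
  have "f (\<Sum>k\<in>K. g k) = (\<Sum>k\<in>K. f (g k))" for g :: "'m \<Rightarrow> 'a" and K
    by (induction K rule: infinite_finite_induct) (simp_all add: assms)
  then show ?thesis
    by (simp add: vec_eq_iff matrix_matrix_mult_def assms(3))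
qed

lemma map_matrix_mat: "f 0 = 0 \<Longrightarrow> map_matrix f (mat c) = mat (f c)"
  by (simp add: vec_eq_iff mat_def)

lemma matrix_inv_eqI:
  fixes A B :: "'a::field^'n^'n"
  assumes "A ** B = mat 1"
  shows "matrix_inv A = B"
proof -
  have "B ** A = mat 1" using assms by (rule matrix_left_right_inverse1)
  with assms have "\<exists>A'. A ** A' = mat 1 \<and> A' ** A = mat 1" by blast
  then have "A ** matrix_inv A = mat 1"
    unfolding matrix_inv_def by (rule someI2_ex) simp
  then have "B ** A ** matrix_inv A = B"
    by (simp flip: matrix_mul_assoc)
  then show ?thesis using \<open>B ** A = mat 1\<close> by simp
qed

lemma J4_nth [simp]:
  "J4 $ 1 $ 1 = 0" "J4 $ 1 $ 2 = 0" "J4 $ 1 $ 3 = 0" "J4 $ 1 $ 4 = 1"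
  "J4 $ 2 $ 1 = 0" "J4 $ 2 $ 2 = 0" "J4 $ 2 $ 3 = 1" "J4 $ 2 $ 4 = 0"
  "J4 $ 3 $ 1 = 0" "J4 $ 3 $ 2 = -1" "J4 $ 3 $ 3 = 0" "J4 $ 3 $ 4 = 0"
  "J4 $ 4 $ 1 = -1" "J4 $ 4 $ 2 = 0" "J4 $ 4 $ 3 = 0" "J4 $ 4 $ 4 = 0"
  by (simp_all add: J4_def block_nth J2_def mat2_nth)

lemma J4_J4: "J4 ** J4 = (mat (- 1) :: 'a::comm_ring_1^4^4)"
  by (simp add: vec_eq_iff forall_4 matrix_matrix_mult_def sum_4 mat_def)

lemma map_matrix_J4:
  assumes "f 0 = 0" "f 1 = 1" "f (- 1) = - 1"
  shows "map_matrix f J4 = J4"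
  by (simp add: vec_eq_iff forall_4 assms)

text \<open>Uniqueness of the multiplier, on which the definite descriptions in \<open>sim\<close>
  and \<open>simGU\<close> rest.\<close>

lemma mat_J4_inject: "mat a ** J4 = mat b ** J4 \<longleftrightarrow> a = b" for a b :: "'a::comm_ring_1"
proof
  assume "mat a ** J4 = mat b ** J4"
  then have "(mat a ** J4) $ 1 $ 4 = (mat b ** J4) $ 1 $ 4" by (rule arg_cong)
  then show "a = b" by (simp add: mat_mult_nth)
qed simp

text \<open>With \<open>c\<close> the identity or the conjugation, this treats both groups at once.\<close>

definition similitude :: "('a::comm_ring_1 \<Rightarrow> 'a) \<Rightarrow> 'a^4^4 \<Rightarrow> 'a \<Rightarrow> bool" where
  "similitude c g m \<longleftrightarrow> transpose (map_matrix c g) ** J4 ** g = mat m ** J4"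

lemma similitude_mult:
  assumes "similitude c g m" "similitude c h m'"
    and "c 0 = 0" "\<And>x y. c (x + y) = c x + c y" "\<And>x y. c (x * y) = c x * c y"
  shows "similitude c (g ** h) (m * m')"
proof -
  have "transpose (map_matrix c (g ** h)) ** J4 ** (g ** h)
      = transpose (map_matrix c h) ** (transpose (map_matrix c g) ** J4 ** g) ** h"
    by (simp add: map_matrix_mult[where f = c, OF assms(3-5)] matrix_transpose_mul matrix_mul_assoc)
  also have "\<dots> = mat m ** (transpose (map_matrix c h) ** J4 ** h)"
    using assms(1) by (simp add: similitude_def matrix_mul_assoc mat_commute[of _ m])
  also have "\<dots> = mat (m * m') ** J4"
    using assms(2) by (simp add: similitude_def matrix_mul_assoc mat_mult_mat)
  finally show ?thesis by (simp add: similitude_def)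
qed

lemma similitude_mat: "similitude c (mat z) (c z * z)" if "c 0 = 0"
proof -
  have "mat (c z) ** J4 ** mat z = mat (c z) ** mat z ** J4"
    by (simp add: mat_commute[of J4] flip: matrix_mul_assoc)
  then show ?thesis using that by (simp add: similitude_def map_matrix_mat mat_mult_mat)
qed

text \<open>\<open>J4\<close> squares to -1, so the similitude relation itself exhibits a left
  inverse of \<open>g\<close>.\<close>

lemma similitude_invertible:
  fixes g :: "'a::field^4^4"
  assumes "similitude c g m" "m \<noteq> 0"
  shows "invertible g"
proof -
  have "mat (- inverse m) ** J4 ** (transpose (map_matrix c g) ** J4 ** g) = mat 1"
  proof -
    have "mat (- inverse m) ** J4 ** (mat m ** J4) = mat (- inverse m) ** mat m ** (J4 ** J4)"
      by (simp add: matrix_mul_assoc) (simp add: matrix_mul_assoc[symmetric] mat_commute[of J4])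
    then show ?thesis using assms by (simp add: similitude_def J4_J4 mat_mult_mat)
  qed
  then show ?thesis
    unfolding invertible_left_inverse by (metis matrix_mul_assoc)
qed

lemma GSp4_iff: "h \<in> GSp4 \<longleftrightarrow> (\<exists>m. m \<noteq> 0 \<and> similitude (\<lambda>x. x) h m)"
  unfolding GSp4_def using similitude_invertible[of "\<lambda>x. x" h] by (auto simp: similitude_def map_matrix_id)

lemma sim_eqI: "similitude (\<lambda>x. x) h m \<Longrightarrow> sim h = m"
  by (simp add: sim_def similitude_def map_matrix_id mat_J4_inject)

lemma GSp4I: "similitude (\<lambda>x. x) h m \<Longrightarrow> m \<noteq> 0 \<Longrightarrow> h \<in> GSp4"
  by (auto simp: GSp4_iff)

lemma GSp4_similitude: "h \<in> GSp4 \<Longrightarrow> similitude (\<lambda>x. x) h (sim h) \<and> sim h \<noteq> 0"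
  unfolding GSp4_iff using sim_eqI by blast

lemma GSp4_mult:
  assumes "g \<in> GSp4" "h \<in> GSp4"
  shows "g ** h \<in> GSp4"
  using similitude_mult[of "\<lambda>x. x" g "sim g" h "sim h"] assms
  by (intro GSp4I[of _ "sim g * sim h"]) (simp_all add: GSp4_similitude)

lemma mat_1_GSp4: "mat 1 \<in> GSp4" "sim (mat 1) = 1"
  using similitude_mat[of "\<lambda>x. x" 1] GSp4I[of "mat 1" 1] sim_eqI[of "mat 1" 1] by simp_all

lemma GSp4_inverse:
  fixes h :: "'f::local_field^4^4"
  assumes "h \<in> GSp4"
  obtains h' where "h' \<in> GSp4" "h' ** h = mat 1" "h ** h' = mat 1"
proof -
  obtain h' where h': "h ** h' = mat 1" "h' ** h = mat 1"
    using assms unfolding GSp4_def invertible_def by blast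
  obtain m where m: "m \<noteq> 0" "transpose h ** J4 ** h = mat m ** J4"
    using assms by (auto simp: GSp4_def)
  have "transpose h' ** (transpose h ** J4 ** h) ** h' = J4"
    using h' by (simp add: matrix_mul_assoc flip: matrix_transpose_mul) (simp flip: matrix_mul_assoc add: h')
  then have "mat m ** (transpose h' ** J4 ** h') = J4"
    unfolding m by (simp add: matrix_mul_assoc mat_commute[of _ m])
  then have "mat (inverse m) ** (mat m ** (transpose h' ** J4 ** h')) = mat (inverse m) ** J4" by simp
  then have "similitude (\<lambda>x. x) h' (inverse m)"
    using m by (simp add: similitude_def map_matrix_id matrix_mul_assoc mat_mult_mat)
  then have "h' \<in> GSp4" using m(1) by (intro GSp4I[of _ "inverse m"]) simp_all
  then show thesis using h' that by blast
qed

section \<open>Elements of the Siegel parabolic\<close>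

lemma similitude_m_mu: "similitude c (m_mu u) u" if "c 0 = 0" "c 1 = 1" "c u = u"
  using that by (simp add: similitude_def m_mu_def vec_eq_iff forall_4 matrix_matrix_mult_def sum_4 transpose_def
      block_nth mat_def)

lemma m_mu_GSp4: "u \<noteq> 0 \<Longrightarrow> m_mu u \<in> GSp4" and sim_m_mu: "sim (m_mu u) = u"
  using similitude_m_mu[of "\<lambda>x. x" u] GSp4I[of "m_mu u" u] sim_eqI[of "m_mu u" u] by simp_all

lemma m_mu_PH: "u \<noteq> 0 \<Longrightarrow> m_mu u \<in> PH"
  by (simp add: PH_def m_mu_GSp4) (simp add: m_mu_def block_nth)

lemma delta_PH_m_mu: "delta_PH (m_mu u) = inverse (absv u) ^ 3"
  by (simp add: delta_PH_def sim_m_mu absv_divide inverse_eq_divide)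
     (simp add: m_mu_def block_nth det_2 mat2_nth mat_def absv_1)

text \<open>By the adjugate formula the factor \<open>det h\<close> of the lower block cancels the
  determinant in the inverse, and the two factors \<open>J2\<close> move the entries back to their
  places up to sign.\<close>

lemma hstar_eq:
  fixes h :: "'a::field^2^2"
  assumes "invertible h"
  shows "hstar h = block h 0 0 (mat2 (h$1$1) (- h$1$2) (- h$2$1) (h$2$2))"
proof -
  have d: "det h \<noteq> 0" using assms by (simp add: invertible_det_nz)
  have "h ** (mat (inverse (det h)) ** mat2 (h$2$2) (- h$1$2) (- h$2$1) (h$1$1)) = mat (inverse (det h)) ** mat (det h)"
    unfolding mat_commute[of _ "inverse (det h)", symmetric] matrix_mul_assoc
    unfolding mat_commute[of _ "inverse (det h)"]
    by (rule arg_cong) (simp add: vec_eq_iff forall_2 matrix_matrix_mult_def sum_2 mat2_nth mat_def det_2 algebra_simps)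
  then have "matrix_inv h = mat (inverse (det h)) ** mat2 (h$2$2) (- h$1$2) (- h$2$1) (h$1$1)"
    using d by (intro matrix_inv_eqI) (simp add: mat_mult_mat)
  then have "mat (det h) ** J2 ** transpose (matrix_inv h) ** J2
      = mat (det h) ** mat (inverse (det h)) ** mat2 (h$1$1) (- h$1$2) (- h$2$1) (h$2$2)"
    by (simp add: vec_eq_iff forall_2 matrix_matrix_mult_def sum_2 mat2_nth J2_def transpose_def mat_def mult.assoc)
  then show ?thesis using d by (simp add: hstar_def levi_def mat_mult_mat)
qed

lemma similitude_hstar:
  fixes h :: "'a::field^2^2"
  assumes "invertible h"
  shows "similitude (\<lambda>x. x) (hstar h) (det h)"
  by (simp add: similitude_def hstar_eq[OF assms] vec_eq_iff forall_4 matrix_matrix_mult_def sum_4 transpose_def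
      block_nth mat2_nth mat_def det_2 algebra_simps)

lemma similitude_siegel_unip:
  assumes "c 0 = 0" "c 1 = 1" "c x = x" "c y = y" "c b = a" "c a = b"
  shows "similitude c (siegel_unip a x y b) 1"
  by (simp add: similitude_def siegel_unip_def vec_eq_iff forall_4 matrix_matrix_mult_def sum_4 transpose_def
      block_nth mat2_nth mat_def assms)

lemma GL2_NH_cases:
  fixes g :: "'f::local_field^4^4"
  assumes "g \<in> GL2_NH"
  obtains h a x y where "invertible h" "g = hstar h ** siegel_unip a x y a"
  using assms by (auto simp: GL2_NH_def)

text \<open>The multiplier of \<open>hstar h\<close> is the determinant of its own upper block, so
  the modulus is trivial here, and with it every power of the modulus.\<close>

lemma GL2_NH_PH:
  fixes g :: "'f::local_field^4^4"
  assumes "g \<in> GL2_NH"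
  shows "g \<in> PH" "delta_PH g = 1"
proof -
  obtain h :: "'f^2^2" and a x y where h: "invertible h" and g: "g = hstar h ** siegel_unip a x y a"
    using assms by (rule GL2_NH_cases)
  have d: "det h \<noteq> 0" using h by (simp add: invertible_det_nz)
  have "similitude (\<lambda>x. x) g (det h * 1)"
    unfolding g by (intro similitude_mult similitude_hstar h similitude_siegel_unip) simp_all
  then have s: "g \<in> GSp4" "sim g = det h"
    using d GSp4I[of g "det h"] sim_eqI[of g "det h"] by simp_all
  have e: "g$3$1 = 0" "g$3$2 = 0" "g$4$1 = 0" "g$4$2 = 0"
    "g$1$1 = h$1$1" "g$1$2 = h$1$2" "g$2$1 = h$2$1" "g$2$2 = h$2$2"
    unfolding g hstar_eq[OF h] siegel_unip_def
    by (simp_all add: matrix_matrix_mult_def sum_4 block_nth mat_def)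
  show "g \<in> PH" using s e by (simp add: PH_def)
  show "delta_PH g = 1" using d by (simp add: delta_PH_def s e mat2_collapse absv_1)
qed

lemma GL2_NH_GSp4: "g \<in> GL2_NH \<Longrightarrow> g \<in> GSp4"
  using GL2_NH_PH(1) by (auto simp: PH_def)

lemma mat_1_GL2_NH: "mat 1 \<in> (GL2_NH :: ('f::local_field^4^4) set)"
proof -
  have i: "invertible (mat 1 :: 'f^2^2)" by (auto simp: invertible_def)
  have "hstar (mat 1) ** siegel_unip 0 0 0 0 = (mat 1 :: 'f^4^4)"
    unfolding hstar_eq[OF i] siegel_unip_def
    by (simp add: vec_eq_iff forall_4 matrix_matrix_mult_def sum_4 block_nth mat2_nth mat_def)
  then show ?thesis unfolding GL2_NH_def using i by (intro CollectI exI conjI) (auto intro: sym)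
qed

lemma section_left_invariant:
  fixes f :: "'f::local_field^4^4 \<Rightarrow> complex"
  assumes "f \<in> section_space s" "g \<in> GL2_NH" "h \<in> GSp4"
  shows "f (g ** h) = f h"
  using assms GL2_NH_PH[OF assms(2)]
  by (auto simp: section_space_def smooth_ind_def matrix_group_def)

lemma section_m_mu:
  fixes f :: "'f::local_field^4^4 \<Rightarrow> complex"
  assumes "f \<in> section_space s" "u \<noteq> 0" "h \<in> GSp4"
  shows "f (m_mu u ** h) = of_real (inverse (absv u) ^ 3) powr ((s + 1) / 3) * f h"
  using assms m_mu_PH[OF assms(2)]
  by (auto simp: section_space_def smooth_ind_def matrix_group_def delta_PH_m_mu simp del: of_real_power)

lemma continuous_matrix_mult_left:
  fixes A :: "'a::local_field^'n^'m"
  shows "continuous_on X (\<lambda>B. A ** B)"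
  unfolding matrix_matrix_mult_def
  by (intro continuous_on_vec_lambda continuous_on_sum continuous_on_mult' continuous_on_const continuous_on_component continuous_on_id)

section \<open>The symplectic similitudes inside the unitary ones\<close>

context unramified_quadratic_ext
begin

lemma map_\<iota>_mult: "map_matrix \<iota> (A ** B) = map_matrix \<iota> A ** map_matrix \<iota> B"
  by (rule map_matrix_mult) (simp_all add: \<iota>_0 \<iota>_add \<iota>_mult)

lemma map_\<iota>_mat: "map_matrix \<iota> (mat c) = mat (\<iota> c)"
  by (simp add: map_matrix_mat \<iota>_0)

lemma continuous_map_\<iota>: "continuous_on X (map_matrix \<iota>)"
  unfolding map_matrix_def
  by (intro continuous_on_vec_lambda continuous_on_compose2[OF continuous_\<iota>[of UNIV]] continuous_on_component continuous_on_id subset_UNIV)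

lemma GU_iff: "g \<in> GU \<iota> cj \<longleftrightarrow> (\<exists>m. m \<noteq> 0 \<and> similitude cj g (\<iota> m))"
  using similitude_invertible[of cj g] by (auto simp: GU_def similitude_def \<iota>_eq_0_iff)

lemma GUI: "similitude cj g (\<iota> m) \<Longrightarrow> m \<noteq> 0 \<Longrightarrow> g \<in> GU \<iota> cj"
  by (auto simp: GU_iff)

lemma simGU_eqI: "similitude cj g (\<iota> m) \<Longrightarrow> simGU \<iota> cj g = m"
  by (simp add: simGU_def similitude_def mat_J4_inject \<iota>_eq_iff)

lemma GU_OI: "similitude cj g (\<iota> m) \<Longrightarrow> absv m = 1 \<Longrightarrow> (\<And>i j. absv (g$i$j) \<le> 1) \<Longrightarrow> g \<in> GU_O \<iota> cj"
  using GUI[of g m] absv_eq_0_iff[of m] by (cases "m = 0") (simp_all add: GU_O_def simGU_eqI)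

lemma similitude_map_\<iota>:
  assumes "similitude (\<lambda>x. x) h m"
  shows "similitude cj (map_matrix \<iota> h) (\<iota> m)"
proof -
  have "map_matrix cj (map_matrix \<iota> h) = map_matrix \<iota> h"
    by (simp add: vec_eq_iff cj_\<iota>)
  moreover have "map_matrix \<iota> (transpose h ** J4 ** h) = map_matrix \<iota> (mat m ** J4)"
    using assms by (simp add: similitude_def map_matrix_id)
  ultimately show ?thesis
    by (simp add: similitude_def map_\<iota>_mult map_\<iota>_mat transpose_map_matrix map_matrix_J4 \<iota>_0 \<iota>_one \<iota>_minus)
qed

lemma map_\<iota>_GU: "h \<in> GSp4 \<Longrightarrow> map_matrix \<iota> h \<in> GU \<iota> cj"
  using similitude_map_\<iota> GSp4_similitude GUI by blast

lemma map_\<iota>_GU_O: "h \<in> GSp4_O \<Longrightarrow> map_matrix \<iota> h \<in> GU_O \<iota> cj"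
  using similitude_map_\<iota>[of h "sim h"] GSp4_similitude[of h]
  by (intro GU_OI) (auto simp: GSp4_O_def absv_\<iota> absv_nonneg power_le_one)

lemma mat_GU:
  assumes "z \<noteq> 0"
  shows "mat (\<iota> z) \<in> GU \<iota> cj"
  using similitude_mat[of cj "\<iota> z"] assms by (intro GUI[of _ "z * z"]) (simp_all add: cj_0 cj_\<iota> \<iota>_mult)

end

text \<open>Up to the centre, which acts trivially, \<open>m_mu u\<close> is the dilation by 1/u. At
  powers of the uniformizer these are the elements at which the values of \<open>\<Lambda>\<close>
  are prescribed.\<close>

definition dilation :: "'a::comm_ring_1 \<Rightarrow> 'a^4^4" where
  "dilation z = block (mat z) 0 0 (mat 1)"

lemma dilation_mult: "dilation (z * w) = dilation z ** dilation w"
  by (simp add: dilation_def vec_eq_iff forall_4 matrix_matrix_mult_def sum_4 block_nth mat_def)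

lemma dilation_siegel_unip:
  fixes z :: "'a::field"
  shows "dilation z ** siegel_unip a x y b = siegel_unip (z * a) (z * x) (z * y) (z * b) ** dilation z"
  by (simp add: dilation_def siegel_unip_def vec_eq_iff forall_4 matrix_matrix_mult_def sum_4 block_nth mat2_nth mat_def)

lemma similitude_dilation: "similitude c (dilation z) z" if "c 0 = 0" "c 1 = 1" "c z = z"
  using that by (simp add: similitude_def dilation_def vec_eq_iff forall_4 matrix_matrix_mult_def sum_4 transpose_def
      block_nth mat_def)

lemma m_mu_eq_dilation: "m_mu u = mat u ** dilation (inverse u)" if "u \<noteq> 0" for u :: "'a::field"
  using that by (simp add: m_mu_def dilation_def vec_eq_iff forall_4 mat_mult_nth block_nth) (simp add: mat_def)

section \<open>The Weyl character formula\<close>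

lemma ex_mult: "ex a b * ex c d = ex (a + c) (b + d)"
  by (auto simp: ex_def mult_single vec_eq_iff intro!: arg_cong2[where f=Poly_Mapping.single])

lemma const_laurent_mult: "const_laurent c * const_laurent d = const_laurent (c * d)"
  by (simp add: const_laurent_def mult_single)

lemma const_laurent_diff: "const_laurent c - const_laurent d = const_laurent (c - d)"
  by (simp add: const_laurent_def single_diff)

lemma const_laurent_1: "const_laurent 1 = 1"
  by (simp add: const_laurent_def)

lemma ex_0: "ex 0 0 = 1"
  by (simp add: ex_def vec_eq_iff flip: single_one)
     (metis (mono_tags) zero_index vec_eq_iff vec_lambda_beta)

text \<open>Reduces additive statements, such as multiplicativity of evaluation, to
  monomials.\<close>

lemma laurent_induct [case_names monomial add]:
  assumes monomial: "\<And>c a b. P (const_laurent c * ex a b)"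
    and add: "\<And>f g. P f \<Longrightarrow> P g \<Longrightarrow> P (f + g)"
  shows "P f"
proof -
  have single: "Poly_Mapping.single k c = const_laurent c * ex (k$1) (k$2)" for k c
  proof -
    have "(\<chi> i. if i = 1 then k$1 else k$2) = k"
      by (simp add: vec_eq_iff forall_2)
    then show ?thesis by (simp add: const_laurent_def ex_def mult_single)
  qed
  show ?thesis
  proof (induction f rule: Poly_Mapping.update_induct)
    case const
    then show ?case using monomial[of 0] by (simp add: const_laurent_def)
  next
    case (update f a b)
    have "Poly_Mapping.update a b f = f + Poly_Mapping.single a b"
      using update by (intro poly_mapping_eqI) (auto simp: lookup_update lookup_add lookup_single in_keys_iff when_def)
    then show ?case using update.IH monomial by (metis add single)
  qed
qed

lemma laurent_eval_add: "laurent_eval t1 t2 (f + g) = laurent_eval t1 t2 f + laurent_eval t1 t2 g"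
  unfolding laurent_eval_def
  by (rule setsum_keys_plus_distrib[where f = "\<lambda>k c. c * t1 powi (k$1) * t2 powi (k$2)"]) (simp_all add: algebra_simps)

lemma laurent_eval_monomial: "laurent_eval t1 t2 (const_laurent c * ex a b) = c * t1 powi a * t2 powi b"
  by (simp add: laurent_eval_def const_laurent_def ex_def mult_single)

lemma laurent_eval_ex: "laurent_eval t1 t2 (ex a b) = t1 powi a * t2 powi b"
  using laurent_eval_monomial[of t1 t2 1 a b] by (simp add: const_laurent_1)

lemma laurent_eval_const: "laurent_eval t1 t2 (const_laurent c) = c"
  using laurent_eval_monomial[of t1 t2 c 0 0] by (simp add: ex_0)

text \<open>For a zero parameter exponents of opposite sign would not add up, as 0
  \<open>powi\<close> (-1) is 0.\<close>

lemma laurent_eval_mult: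
  assumes "t1 \<noteq> 0" "t2 \<noteq> 0"
  shows "laurent_eval t1 t2 (f * g) = laurent_eval t1 t2 f * laurent_eval t1 t2 g"
proof (induction f rule: laurent_induct)
  case (monomial c a b)
  show ?case
  proof (induction g rule: laurent_induct)
    case (monomial d a' b')
    have "const_laurent c * ex a b * (const_laurent d * ex a' b') = const_laurent (c * d) * ex (a + a') (b + b')"
      by (simp add: ac_simps flip: const_laurent_mult ex_mult)
    then show ?case
      using assms by (simp add: laurent_eval_monomial power_int_add)
  qed (simp add: algebra_simps laurent_eval_add)
qed (simp add: algebra_simps laurent_eval_add)

section \<open>Alternating sums and division by the Weyl denominator\<close>

definition weyl_alt :: "int \<Rightarrow> int \<Rightarrow> laurent" where
  "weyl_alt a b = ex a b - ex a (- b) - ex (- a) b + ex (- a) (- b)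
     - ex b a + ex b (- a) + ex (- b) a - ex (- b) (- a)"

lemma weyl_alt_swap: "weyl_alt b a = - weyl_alt a b"
  by (simp add: weyl_alt_def algebra_simps)

lemma alt_sum_add: "alt_sum (f + g) = alt_sum f + alt_sum g"
proof -
  have "(\<Sum>k\<in>Poly_Mapping.keys (f + g). Poly_Mapping.single (w *v k) (of_int (det w) * Poly_Mapping.lookup (f + g) k)) =
    (\<Sum>k\<in>Poly_Mapping.keys f. Poly_Mapping.single (w *v k) (of_int (det w) * Poly_Mapping.lookup f k)) +
    (\<Sum>k\<in>Poly_Mapping.keys g. Poly_Mapping.single (w *v k) (of_int (det w) * Poly_Mapping.lookup g k))" for w :: "int^2^2"
    by (rule setsum_keys_plus_distrib[where f = "\<lambda>k c. Poly_Mapping.single (w *v k) (of_int (det w) * c)"])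
       (simp_all add: algebra_simps single_add)
  then show ?thesis by (simp add: alt_sum_def sum.distrib)
qed

lemma mat2_eq_iff: "mat2 a b c d = mat2 a' b' c' d' \<longleftrightarrow> a = a' \<and> b = b' \<and> c = c' \<and> d = d'"
  by (auto simp: mat2_def vec_eq_iff forall_2)

lemma ex1_2: "(\<exists>!j::2. P j) \<longleftrightarrow> P 1 \<noteq> P 2"
  by (metis exhaust_2 zero_neq_one)

lemma signed_perms_eq:
  "signed_perms = {mat2 1 0 0 1, mat2 1 0 0 (-1), mat2 (-1) 0 0 1, mat2 (-1) 0 0 (-1),
     mat2 0 1 1 0, mat2 0 1 (-1) 0, mat2 0 (-1) 1 0, mat2 0 (-1) (-1) 0}" (is "_ = ?R")
proof -
  have "w \<in> signed_perms \<longleftrightarrow> w \<in> ?R" for w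
  proof -
    have "w = mat2 (w$1$1) (w$1$2) (w$2$1) (w$2$2)"
      by (simp add: mat2_def vec_eq_iff forall_2)
    then obtain a b c d where w: "w = mat2 a b c d" by blast
    show ?thesis
      unfolding w mat2_eq_iff insert_iff empty_iff signed_perms_def mem_Collect_eq ex1_2 forall_2
      by (simp add: mat2_def) auto
  qed
  then show ?thesis by blast
qed

lemma alt_sum_monomial: "alt_sum (const_laurent c * ex a b) = const_laurent c * weyl_alt a b"
proof -
  let ?v = "\<chi> i::2. if i = 1 then a else b"
  have f: "const_laurent c * ex a b = Poly_Mapping.single ?v c"
    by (simp add: const_laurent_def ex_def mult_single)
  have "(\<Sum>k\<in>Poly_Mapping.keys (const_laurent c * ex a b).
      Poly_Mapping.single (w *v k) (of_int (det w) * Poly_Mapping.lookup (const_laurent c * ex a b) k))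
    = Poly_Mapping.single (w *v ?v) (of_int (det w) * c)" for w :: "int^2^2"
    by (simp add: f)
  moreover have "mat2 x y z w *v ?v = (\<chi> i. if i = 1 then x * a + y * b else z * a + w * b)" for x y z w
    by (simp add: mat2_def matrix_vector_mult_def vec_eq_iff forall_2 sum_2)
  moreover have "det (mat2 x y z w) = x * w - y * z" for x y z w :: int
    by (simp add: det_2 mat2_def)
  moreover have "Poly_Mapping.single (\<chi> i. if i = 1 then a else b) c = const_laurent c * ex a b"
    "Poly_Mapping.single (\<chi> i. if i = 1 then a else b) (- c) = - (const_laurent c * ex a b)" for a b :: int
    by (simp_all add: const_laurent_def ex_def mult_single single_uminus)
  ultimately show ?thesis
    unfolding alt_sum_def signed_perms_eq
    by (simp add: mat2_eq_iff weyl_alt_def ring_distribs)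
qed

lemma alt_sum_ex: "alt_sum (ex a b) = weyl_alt a b"
  using alt_sum_monomial[of 1 a b] by (simp add: const_laurent_1)

lemma lookup_mult_ex: "Poly_Mapping.lookup (f * ex a b) k = Poly_Mapping.lookup f (k - (\<chi> i. if i = 1 then a else b))"
proof (induction f rule: laurent_induct)
  case (monomial c a' b')
  then show ?case
    by (auto simp: const_laurent_def ex_def mult_single lookup_single when_def algebra_simps)
next
  case (add f g)
  then show ?case by (simp add: lookup_add ring_distribs)
qed

text \<open>The exponent \<open>(2, 1)\<close> is the only one of the denominator at which \<open>2 k\<^sub>1 + k\<^sub>2\<close> is maximal.\<close>

lemma weyl_denominator_cancel:
  assumes "P * weyl_alt 2 1 = 0"
  shows "P = 0"
proof (rule ccontr)
  assume "P \<noteq> 0"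
  define h :: "int^2 \<Rightarrow> int" where "h k = 2 * k$1 + k$2" for k
  define v :: "int \<Rightarrow> int \<Rightarrow> int^2" where "v a b = (\<chi> i. if i = 1 then a else b)" for a b
  have v: "v a b $ 1 = a" "v a b $ 2 = b" for a b by (simp_all add: v_def)
  have "Max (h ` Poly_Mapping.keys P) \<in> h ` Poly_Mapping.keys P"
    using \<open>P \<noteq> 0\<close> by (intro Max_in) auto
  then obtain k where k: "k \<in> Poly_Mapping.keys P" "h k = Max (h ` Poly_Mapping.keys P)" by auto
  have "h l \<le> h k" if "l \<in> Poly_Mapping.keys P" for l
    unfolding k(2) using that by (intro Max_ge) auto
  then have z: "Poly_Mapping.lookup P l = 0" if "h l > h k" for l
    using that by (force simp: in_keys_iff)
  have "0 = Poly_Mapping.lookup (P * weyl_alt 2 1) (k + v 2 1)"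
    using assms by simp
  also have "\<dots> = Poly_Mapping.lookup P k"
    by (simp add: weyl_alt_def lookup_add lookup_minus ring_distribs lookup_mult_ex z h_def v flip: v_def)
  finally show False using k by (simp add: in_keys_iff)
qed

text \<open>Cancellation gives the uniqueness behind the definite description, so a quotient may be
  identified by multiplying out.\<close>

lemma weyl_quotient_eqI:
  assumes "P * weyl_alt 2 1 = alt_sum f"
  shows "weyl_quotient f = P"
  unfolding weyl_quotient_def alt_sum_ex
proof (rule the_equality)
  fix Q assume "Q * weyl_alt 2 1 = alt_sum f"
  then have "(Q - P) * weyl_alt 2 1 = 0" using assms by (simp add: algebra_simps)
  then show "Q = P" using weyl_denominator_cancel by (metis eq_iff_diff_eq_0)
qed (fact assms)

section \<open>The characters of highest weight (n, n) through a recurrence\<close>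

primrec geom_conv :: "'a::comm_ring_1 \<Rightarrow> (nat \<Rightarrow> 'a) \<Rightarrow> nat \<Rightarrow> 'a" where
  "geom_conv x a 0 = a 0"
| "geom_conv x a (Suc n) = a (Suc n) + x * geom_conv x a n"

text \<open>The coefficients of \<open>(1 + Y) / \<Prod> (1 - x\<^sub>i Y)\<close>. This is polymorphic in order to be used both in
  the Laurent ring and after evaluation, where the Weyl denominator may vanish.\<close>

definition chi5 :: "'a::comm_ring_1 \<Rightarrow> 'a \<Rightarrow> 'a \<Rightarrow> 'a \<Rightarrow> nat \<Rightarrow> 'a" where
  "chi5 x1 x2 x3 x4 = geom_conv x1 (geom_conv x2 (geom_conv x3 (geom_conv x4 (\<lambda>n. if n \<le> 1 then 1 else 0))))"

lemma chi5_recurrence: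
  fixes x1 x2 x3 x4 :: "'a::comm_ring_1"
  defines "e1 \<equiv> x1 + x2 + x3 + x4"
    and "e2 \<equiv> x1 * x2 + x1 * x3 + x1 * x4 + x2 * x3 + x2 * x4 + x3 * x4"
    and "e3 \<equiv> x1 * x2 * x3 + x1 * x2 * x4 + x1 * x3 * x4 + x2 * x3 * x4"
    and "e4 \<equiv> x1 * x2 * x3 * x4"
    and "c \<equiv> chi5 x1 x2 x3 x4"
  shows "c 0 = 1" "c 1 = e1 * c 0 + 1" "c 2 = e1 * c 1 - e2 * c 0" "c 3 = e1 * c 2 - e2 * c 1 + e3 * c 0"
    and "c (n + 4) = e1 * c (n + 3) - e2 * c (n + 2) + e3 * c (n + 1) - e4 * c n"
proof -
  show "c 0 = 1" "c 1 = e1 * c 0 + 1" "c 2 = e1 * c 1 - e2 * c 0" "c 3 = e1 * c 2 - e2 * c 1 + e3 * c 0"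
    by (simp_all add: c_def chi5_def e1_def e2_def e3_def eval_nat_numeral algebra_simps)
  define d :: "nat \<Rightarrow> 'a" where "d n = (if n \<le> 1 then 1 else 0)" for n
  define c4 where "c4 = geom_conv x4 d"
  define c3 where "c3 = geom_conv x3 c4"
  define c2 where "c2 = geom_conv x2 c3"
  have c: "c = geom_conv x1 c2"
    unfolding c_def chi5_def c2_def c3_def c4_def d_def ..
  \<comment> \<open>Multiplication by 1 - x Y undoes \<open>geom_conv x\<close>. Once all four
    factors are stripped only 1 + Y remains, whose coefficient in degree n + 4 is zero.\<close>
  have T: "c2 (Suc m) = c (Suc m) - x1 * c m" "c3 (Suc m) = c2 (Suc m) - x2 * c2 m"
    "c4 (Suc m) = c3 (Suc m) - x3 * c3 m" "d (Suc m) = c4 (Suc m) - x4 * c4 m" for m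
    by (simp_all add: c c2_def c3_def c4_def)
  have "0 = d (Suc (Suc (Suc (Suc n))))" by (simp add: d_def)
  also have "\<dots> = c (n + 4) - e1 * c (n + 3) + e2 * c (n + 2) - e3 * c (n + 1) + e4 * c n"
    unfolding T e1_def e2_def e3_def e4_def by (simp add: eval_nat_numeral algebra_simps)
  finally show "c (n + 4) = e1 * c (n + 3) - e2 * c (n + 2) + e3 * c (n + 1) - e4 * c n"
    by (simp add: algebra_simps)
qed

abbreviation chi_laurent :: "nat \<Rightarrow> laurent" where
  "chi_laurent \<equiv> chi5 (ex 1 1) (ex (-1) (-1)) (ex 1 (-1)) (ex (-1) 1)"

lemma quartic_root:
  fixes x1 x2 x3 x4 :: "'a::comm_ring_1"
  assumes "x \<in> {x1, x2, x3, x4}"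
  shows "x ^ 4 = (x1 + x2 + x3 + x4) * x ^ 3 - (x1 * x2 + x1 * x3 + x1 * x4 + x2 * x3 + x2 * x4 + x3 * x4) * x ^ 2
    + (x1 * x2 * x3 + x1 * x2 * x4 + x1 * x3 * x4 + x2 * x3 * x4) * x - x1 * x2 * x3 * x4"
  using assms by (auto simp: eval_nat_numeral algebra_simps)

lemma ex_power: "ex a b ^ k = ex (int k * a) (int k * b)"
  by (induction k) (simp_all add: ex_0 ex_mult algebra_simps)

text \<open>The eight monomials of \<open>weyl_alt (n + 2) (n + 1)\<close> pair up by their signs
  into four groups, and raising n by k multiplies the groups by the k-th powers of x1, ..., x4. Each
  sequence of powers solves the recurrence by \<open>quartic_root\<close>. Integer n allows a start
  at negative n.\<close>

lemma weyl_alt_recurrence: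
  fixes n :: int
  defines "x1 \<equiv> ex 1 1" and "x2 \<equiv> ex (-1) (-1)" and "x3 \<equiv> ex 1 (-1)" and "x4 \<equiv> ex (-1) 1"
  shows "weyl_alt (n + 6) (n + 5) = (x1 + x2 + x3 + x4) * weyl_alt (n + 5) (n + 4)
     - (x1 * x2 + x1 * x3 + x1 * x4 + x2 * x3 + x2 * x4 + x3 * x4) * weyl_alt (n + 4) (n + 3)
     + (x1 * x2 * x3 + x1 * x2 * x4 + x1 * x3 * x4 + x2 * x3 * x4) * weyl_alt (n + 3) (n + 2)
     - x1 * x2 * x3 * x4 * weyl_alt (n + 2) (n + 1)"
proof -
  define d1 where "d1 = (ex 2 1 - ex 1 2) * ex n n"
  define d2 where "d2 = (ex (-2) (-1) - ex (-1) (-2)) * ex (- n) (- n)"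
  define d3 where "d3 = (ex 1 (-2) - ex 2 (-1)) * ex n (- n)"
  define d4 where "d4 = (ex (-1) 2 - ex (-2) 1) * ex (- n) n"
  have shift: "ex (m + 2) (m + 1) = ex 2 1 * ex m m" "ex (m + 2) (- (m + 1)) = ex 2 (-1) * ex m (- m)"
    "ex (- (m + 2)) (m + 1) = ex (-2) 1 * ex (- m) m" "ex (- (m + 2)) (- (m + 1)) = ex (-2) (-1) * ex (- m) (- m)"
    "ex (m + 1) (m + 2) = ex 1 2 * ex m m" "ex (m + 1) (- (m + 2)) = ex 1 (-2) * ex m (- m)"
    "ex (- (m + 1)) (m + 2) = ex (-1) 2 * ex (- m) m" "ex (- (m + 1)) (- (m + 2)) = ex (-1) (-2) * ex (- m) (- m)" for m
    by (simp_all add: ex_mult algebra_simps)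
  have pow: "ex (n + int k) (n + int k) = x1 ^ k * ex n n" "ex (- (n + int k)) (- (n + int k)) = x2 ^ k * ex (- n) (- n)"
    "ex (n + int k) (- (n + int k)) = x3 ^ k * ex n (- n)" "ex (- (n + int k)) (n + int k) = x4 ^ k * ex (- n) n" for k
    by (simp_all add: x1_def x2_def x3_def x4_def ex_power ex_mult algebra_simps)
  have weyl_alt: "weyl_alt (n + int k + 2) (n + int k + 1) = x1 ^ k * d1 + x2 ^ k * d2 + x3 ^ k * d3 + x4 ^ k * d4" for k
    unfolding weyl_alt_def shift pow d1_def d2_def d3_def d4_def by (simp add: algebra_simps)
  define e1 where "e1 = x1 + x2 + x3 + x4"
  define e2 where "e2 = x1 * x2 + x1 * x3 + x1 * x4 + x2 * x3 + x2 * x4 + x3 * x4"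
  define e3 where "e3 = x1 * x2 * x3 + x1 * x2 * x4 + x1 * x3 * x4 + x2 * x3 * x4"
  define e4 where "e4 = x1 * x2 * x3 * x4"
  have q: "x ^ 4 = e1 * x ^ 3 - e2 * x ^ 2 + e3 * x - e4" if "x \<in> {x1, x2, x3, x4}" for x
    unfolding e1_def e2_def e3_def e4_def by (rule quartic_root[OF that])
  show ?thesis
    using weyl_alt[of 0] weyl_alt[of 1] weyl_alt[of 2] weyl_alt[of 3] weyl_alt[of 4] q[of x1] q[of x2] q[of x3] q[of x4]
    unfolding e1_def[symmetric] e2_def[symmetric] e3_def[symmetric] e4_def[symmetric]
    by (simp add: algebra_simps)
qed

text \<open>Both sides satisfy the same recurrence of order four, so only the starting values need
  comparison; the product of the four roots is 1.\<close>

lemma weyl_alt_eq_chi: "weyl_alt (int n + 2) (int n + 1) = chi_laurent n * weyl_alt 2 1"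
proof -
  let ?c = chi_laurent
  note R = chi5_recurrence[of "ex 1 1" "ex (-1) (-1)" "ex 1 (-1)" "ex (-1) 1"]
  have e4: "ex 1 1 * ex (-1) (-1) * ex 1 (-1) * ex (-1) 1 = 1"
    by (simp add: ex_mult ex_0)
  note A = weyl_alt_recurrence[unfolded e4] and R = R[unfolded e4]
  \<comment> \<open>Numerators vanish on the walls of the Weyl chambers, and (-1, -2) is the image
    of (2, 1) under a reflection. Its sign, met at n = 1, produces the term Y in the numerator 1 + Y
    of \<open>chi5\<close>.\<close>
  have z: "weyl_alt 1 0 = 0" "weyl_alt 0 (-1) = 0" "weyl_alt (-1) (-2) = - weyl_alt 2 1"
    by (simp_all add: weyl_alt_def)
  show ?thesis
  proof (induction n rule: less_induct)
    case (less n)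
    have "n = 0 \<or> n = 1 \<or> n = 2 \<or> n = 3 \<or> n = (n - 4) + 4" by linarith
    then consider "n = 0" | "n = 1" | "n = 2" | "n = 3" | m where "n = m + 4" by blast
    then show ?case
    proof cases
      case 1
      then show ?thesis using R(1) by simp
    next
      case 2
      then show ?thesis using A[of "-3"] unfolding 2 R(2) R(1) by (simp add: z ring_distribs)
    next
      case 3
      have "weyl_alt 3 2 = ?c 1 * weyl_alt 2 1" using less.IH[of 1] 3 by simp
      then show ?thesis using A[of "-2"] unfolding 3 R(3) R(1) by (simp add: z left_diff_distrib mult.assoc)
    next
      case 4
      have "weyl_alt 3 2 = ?c 1 * weyl_alt 2 1" "weyl_alt 4 3 = ?c 2 * weyl_alt 2 1"
        using less.IH[of 1] less.IH[of 2] 4 by simp_all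
      then show ?thesis using A[of "-1"] unfolding 4 R(4) R(1)
        by (simp add: z left_diff_distrib distrib_right[of _ _ "weyl_alt 2 1"] mult.assoc)
    next
      case 5
      have I: "weyl_alt (int m + 2) (int m + 1) = ?c m * weyl_alt 2 1"
        "weyl_alt (int m + 3) (int m + 2) = ?c (m + 1) * weyl_alt 2 1"
        "weyl_alt (int m + 4) (int m + 3) = ?c (m + 2) * weyl_alt 2 1"
        "weyl_alt (int m + 5) (int m + 4) = ?c (m + 3) * weyl_alt 2 1"
        using less.IH[of m] less.IH[of "m + 1"] less.IH[of "m + 2"] less.IH[of "m + 3"] 5
        by (simp_all add: algebra_simps)
      have "weyl_alt (int n + 2) (int n + 1) = weyl_alt (int m + 6) (int m + 5)"
        using 5 by (simp add: algebra_simps)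
      also have "\<dots> = ?c (m + 4) * weyl_alt 2 1"
        unfolding A I R(5) by (simp only: left_diff_distrib distrib_right[of _ _ "weyl_alt 2 1"] mult.assoc mult_1)
      finally show ?thesis using 5 by simp
    qed
  qed
qed

text \<open>Multiplication of the generating function by 1 + c Y, the coefficient of degree -1 being
  read as 0.\<close>

definition add_shift :: "'a::comm_ring_1 \<Rightarrow> (nat \<Rightarrow> 'a) \<Rightarrow> nat \<Rightarrow> 'a" where
  "add_shift c b n = b n + (if n = 0 then 0 else c * b (n - 1))"

text \<open>Of the four monomials in the product, the two carrying the factor with exponent (-1, 1)
  are the coordinate swaps of the other two. Antisymmetry merges each pair, which is the origin of
  the factor 1 - c; at n = 0 the second pair lies on a wall.\<close>

lemma weyl_quotient_shalika:
  fixes c :: complex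
  shows "weyl_quotient (const_laurent e * ex (2 + int n) (1 + int n)
         * (1 + const_laurent c * ex (-1) (-1)) * (1 + const_laurent c * ex (-1) 1))
     = const_laurent (e * (1 - c)) * add_shift (const_laurent c) chi_laurent n" (is "weyl_quotient ?f = ?P")
proof (rule weyl_quotient_eqI)
  let ?C = const_laurent
  have "?f = ?C e * ex (2 + int n) (1 + int n) + ?C (e * c) * ex (1 + int n) (int n)
     + ?C (e * c) * ex (1 + int n) (2 + int n) + ?C (e * c * c) * ex (int n) (1 + int n)"
    by (simp add: ring_distribs ac_simps ex_mult flip: const_laurent_mult)
  then have "alt_sum ?f = ?C e * weyl_alt (2 + int n) (1 + int n) + ?C (e * c) * weyl_alt (1 + int n) (int n)
     + ?C (e * c) * weyl_alt (1 + int n) (2 + int n) + ?C (e * c * c) * weyl_alt (int n) (1 + int n)"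
    by (simp add: alt_sum_add alt_sum_monomial)
  also have "\<dots> = ?C (e * (1 - c)) * (weyl_alt (int n + 2) (int n + 1) + ?C c * weyl_alt (int n + 1) (int n))"
    using weyl_alt_swap[of "2 + int n" "1 + int n"] weyl_alt_swap[of "1 + int n" "int n"]
    by (simp add: ring_distribs ac_simps flip: const_laurent_mult const_laurent_diff)
  also have "weyl_alt (int n + 1) (int n) = (if n = 0 then 0 else chi_laurent (n - 1)) * weyl_alt 2 1"
  proof (cases n)
    case 0
    then show ?thesis by (simp add: weyl_alt_def)
  next
    case (Suc m)
    then show ?thesis using weyl_alt_eq_chi[of m] by (simp add: algebra_simps)
  qed
  also have "?C (e * (1 - c)) * (weyl_alt (int n + 2) (int n + 1) + ?C c * \<dots>) = ?P * weyl_alt 2 1"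
    unfolding weyl_alt_eq_chi add_shift_def by (cases n) (simp_all add: distrib_left distrib_right mult.assoc)
  finally show "?P * weyl_alt 2 1 = alt_sum ?f" ..
qed

section \<open>Evaluation at the Satake parameter and generating functions\<close>

lemma geom_conv_hom:
  assumes "\<And>x y. h (x + y) = h x + h y" "\<And>x y. h (x * y) = h x * h y"
  shows "h (geom_conv x a n) = geom_conv (h x) (\<lambda>n. h (a n)) n"
  by (induction n) (simp_all add: assms)

lemma chi5_hom:
  assumes "\<And>x y. h (x + y) = h x + h y" "\<And>x y. h (x * y) = h x * h y" "h 1 = 1" "h 0 = 0"
  shows "h (chi5 x1 x2 x3 x4 n) = chi5 (h x1) (h x2) (h x3) (h x4) n"
  by (simp add: chi5_def geom_conv_hom[where h = h, OF assms(1,2)] assms if_distrib[of h] cong: if_cong)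

text \<open>Evaluation is a ring homomorphism and passes through \<open>chi5\<close>, where no
  denominator is left; the factor 1 - 1/q cancels the one in the normalization, being nonzero for q
  > 1.\<close>

lemma shalika_value_eq:
  assumes "t1 \<noteq> 0" "t2 \<noteq> 0" "q > 1"
  shows "shalika_value q t1 t2 n = (1 / of_nat q) ^ (2 * n) * (-1) ^ n *
    add_shift (1 / of_nat q) (chi5 (t1 * t2) (1 / (t1 * t2)) (t1 / t2) (t2 / t1)) n"
proof -
  let ?h = "laurent_eval t1 t2"
  have h0: "?h 0 = 0" "?h 1 = 1"
    using laurent_eval_const[of t1 t2] laurent_eval_const[of t1 t2 1]
    by (simp_all add: const_laurent_1) (simp add: laurent_eval_def)
  note h = laurent_eval_add laurent_eval_mult[OF assms(1,2)] h0
  have c: "?h (chi_laurent n) = chi5 (t1 * t2) (1 / (t1 * t2)) (t1 / t2) (t2 / t1) n" for n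
    using assms by (subst chi5_hom[where h = ?h]) (simp_all add: h laurent_eval_ex power_int_minus field_simps)
  define k where "k = 1 - 1 / (of_nat q :: complex)"
  have "(of_nat q :: complex) \<noteq> 1" using assms(3) by simp
  then have "k \<noteq> 0" using assms(3) by (simp add: k_def field_simps)
  then show ?thesis
    unfolding shalika_value_def weyl_quotient_shalika k_def[symmetric]
    by (simp add: add_shift_def h laurent_eval_const c)
qed

text \<open>Absolute convergence is carried along: Cauchy products need it, and it later becomes
  integrability over the quotient.\<close>

definition gen_fun :: "(nat \<Rightarrow> complex) \<Rightarrow> complex \<Rightarrow> complex \<Rightarrow> bool" where
  "gen_fun a y S \<longleftrightarrow> summable (\<lambda>n. norm (a n * y ^ n)) \<and> (\<lambda>n. a n * y ^ n) sums S"

lemma gen_fun_geom_conv: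
  assumes "gen_fun a y S" "norm (x * y) < 1"
  shows "gen_fun (geom_conv x a) y (S / (1 - x * y))"
proof -
  \<comment> \<open>The recursion unrolled is a Cauchy product with the geometric series in x
    y.\<close>
  have eq: "geom_conv x a n * y ^ n = (\<Sum>i\<le>n. (a i * y ^ i) * (x * y) ^ (n - i))" for n
  proof (induction n)
    case (Suc n)
    have "(\<Sum>i\<le>n. (a i * y ^ i) * (x * y) ^ (Suc n - i)) = (x * y) * (\<Sum>i\<le>n. (a i * y ^ i) * (x * y) ^ (n - i))"
      by (simp add: sum_distrib_left Suc_diff_le algebra_simps)
    then show ?case using Suc by (simp add: algebra_simps)
  qed simp
  have a: "summable (\<lambda>n. norm (a n * y ^ n))" and S: "suminf (\<lambda>n. a n * y ^ n) = S"
    using assms(1) by (auto simp: gen_fun_def sums_iff)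
  have g: "summable (\<lambda>n. norm ((x * y) ^ n))"
    using assms(2) by (simp add: norm_power norm_mult)
  have gs: "suminf (\<lambda>n. (x * y) ^ n) = 1 / (1 - x * y)"
    using assms(2) by (rule suminf_geometric)
  have "(\<lambda>n. geom_conv x a n * y ^ n) sums (S / (1 - x * y))"
    using Cauchy_product_sums[OF a g] unfolding S gs eq by simp
  moreover have "summable (\<lambda>n. norm (geom_conv x a n * y ^ n))"
  proof (rule summable_comparison_test[rotated])
    show "summable (\<lambda>n. \<Sum>i\<le>n. norm (a i * y ^ i) * norm ((x * y) ^ (n - i)))"
      by (rule summable_Cauchy_product) (use a g in simp_all)
    show "\<exists>N. \<forall>n\<ge>N. norm (norm (geom_conv x a n * y ^ n)) \<le> (\<Sum>i\<le>n. norm (a i * y ^ i) * norm ((x * y) ^ (n - i)))"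
      unfolding eq by (auto intro!: sum_norm_le simp: norm_mult)
  qed
  ultimately show ?thesis by (simp add: gen_fun_def)
qed

lemma gen_fun_add_shift:
  assumes "gen_fun a y S"
  shows "gen_fun (add_shift c a) y ((1 + c * y) * S)"
proof -
  have eq: "add_shift c a (Suc n) * y ^ Suc n = a (Suc n) * y ^ Suc n + (c * y) * (a n * y ^ n)" for n
    by (simp add: add_shift_def algebra_simps)
  have a: "summable (\<lambda>n. norm (a n * y ^ n))" and S: "(\<lambda>n. a n * y ^ n) sums S"
    using assms by (auto simp: gen_fun_def)
  have "(\<lambda>n. a (Suc n) * y ^ Suc n + (c * y) * (a n * y ^ n)) sums (S - a 0 + (c * y) * S)"
    using S sums_Suc_iff[of "\<lambda>n. a n * y ^ n" "S - a 0"] by (intro sums_add sums_mult) simp_all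
  then have "(\<lambda>n. add_shift c a n * y ^ n) sums ((1 + c * y) * S)"
    unfolding eq[symmetric] by (subst (asm) sums_Suc_iff) (simp add: add_shift_def algebra_simps)
  moreover have "summable (\<lambda>n. norm (add_shift c a n * y ^ n))"
  proof (subst summable_Suc_iff[symmetric], rule summable_comparison_test[rotated])
    show "summable (\<lambda>n. norm (a (Suc n) * y ^ Suc n) + norm (c * y) * norm (a n * y ^ n))"
      using a summable_Suc_iff[of "\<lambda>n. norm (a n * y ^ n)"] by (intro summable_add summable_mult) auto
    show "\<exists>N. \<forall>n\<ge>N. norm (norm (add_shift c a (Suc n) * y ^ Suc n)) \<le>
        norm (a (Suc n) * y ^ Suc n) + norm (c * y) * norm (a n * y ^ n)"
      unfolding eq by (auto simp flip: norm_mult intro: norm_triangle_ineq)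
  qed
  ultimately show ?thesis by (simp add: gen_fun_def)
qed

lemma gen_fun_chi5:
  assumes "norm (x1 * y) < 1" "norm (x2 * y) < 1" "norm (x3 * y) < 1" "norm (x4 * y) < 1"
  shows "gen_fun (chi5 x1 x2 x3 x4) y ((1 + y) / (1 - x4 * y) / (1 - x3 * y) / (1 - x2 * y) / (1 - x1 * y))"
proof -
  have "gen_fun (\<lambda>n. if n \<le> 1 then 1 else 0) y (1 + y)"
  proof -
    have f: "finite {0..1::nat}" by simp
    have "(\<lambda>n. (if n \<le> 1 then 1 else 0) * y ^ n) sums (\<Sum>n\<in>{0..1}. (if n \<le> 1 then 1 else 0) * y ^ n)"
      by (rule sums_finite) auto
    moreover have "summable (\<lambda>n. norm ((if n \<le> 1 then 1 else 0) * y ^ n))"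
      by (rule summable_finite[OF f]) auto
    ultimately show ?thesis by (simp add: gen_fun_def)
  qed
  then show ?thesis unfolding chi5_def by (intro gen_fun_geom_conv assms)
qed

lemma shalika_series:
  assumes "t1 \<noteq> 0" "t2 \<noteq> 0" "q > 1" and s: "\<And>w. w \<in> set (std_weights t1 t2) \<Longrightarrow> norm w < real q powr Re s"
  defines "X \<equiv> of_nat q powr (- s) :: complex"
  shows "summable (\<lambda>n. norm (shalika_value q t1 t2 n * of_nat q ^ (2 * n) * X ^ n))" (is ?A)
    and "(\<lambda>n. shalika_value q t1 t2 n * of_nat q ^ (2 * n) * X ^ n) sums
      ((1 - X\<^sup>2) * (1 - X / of_nat q) * L_std_twisted q t1 t2 s)" (is ?B)
proof -
  have nX: "norm X = real q powr (- Re s)"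
    using assms(3) norm_powr_real_powr[of "of_nat q" "-s"] by (simp add: X_def)
  \<comment> \<open>The hypothesis on \<open>s\<close> says precisely that |w X| < 1 for each
    weight; the weight 1 contributes |X| < 1.\<close>
  have w: "norm (w * - X) < 1" if "w \<in> set (std_weights t1 t2)" for w
    using s[OF that] assms(3) by (simp add: norm_mult nX powr_minus field_simps)
  have w': "norm (t1 * t2 * - X) < 1" "norm (1 / (t1 * t2) * - X) < 1" "norm (t1 / t2 * - X) < 1"
    "norm (t2 / t1 * - X) < 1" "norm (1 * - X) < 1"
    by (rule w, simp add: std_weights_def)+
  have nz: "1 + v \<noteq> 0" if "norm v < 1" for v :: complex
    using that by (metis add_eq_0_iff norm_minus_cancel norm_one less_irrefl)
  have X1: "1 + X \<noteq> 0"
    using nz[of X] w' by simp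
  have eq: "shalika_value q t1 t2 n * of_nat q ^ (2 * n) * X ^ n =
      add_shift (1 / of_nat q) (chi5 (t1 * t2) (1 / (t1 * t2)) (t1 / t2) (t2 / t1)) n * (- X) ^ n" for n
    using assms(3) by (simp add: shalika_value_eq[OF assms(1-3)] power_divide power_minus[of X])
  have "gen_fun (add_shift (1 / of_nat q) (chi5 (t1 * t2) (1 / (t1 * t2)) (t1 / t2) (t2 / t1))) (- X)
    ((1 + 1 / of_nat q * - X) * ((1 + - X) / (1 - t2 / t1 * - X) / (1 - t1 / t2 * - X)
       / (1 - 1 / (t1 * t2) * - X) / (1 - t1 * t2 * - X)))" (is "gen_fun ?b ?y ?S")
    by (intro gen_fun_add_shift gen_fun_chi5 w')
  moreover have "?S = (1 - X\<^sup>2) * (1 - X / of_nat q) * L_std_twisted q t1 t2 s"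
  proof -
    \<comment> \<open>The generating function has four denominators, the L-factor five; the factor
      of the weight 1 cancels against 1 - X^2.\<close>
    have "(1 - X\<^sup>2) * inverse (1 + X) = 1 - X"
      using X1 by (simp add: field_simps power2_eq_square)
    moreover have "L_std_twisted q t1 t2 s = inverse (1 + X) * (inverse (1 + t2 / t1 * X) *
       inverse (1 + t1 / t2 * X) * inverse (1 + 1 / (t1 * t2) * X) * inverse (1 + t1 * t2 * X))"
      by (simp add: L_std_twisted_def std_weights_def X_def ac_simps)
    ultimately have "(1 - X\<^sup>2) * L_std_twisted q t1 t2 s = (1 - X) * (inverse (1 + t2 / t1 * X) *
       inverse (1 + t1 / t2 * X) * inverse (1 + 1 / (t1 * t2) * X) * inverse (1 + t1 * t2 * X))"
      by (metis mult.assoc)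
    then have "(1 - X\<^sup>2) * (1 - X / of_nat q) * L_std_twisted q t1 t2 s =
       (1 - X / of_nat q) * ((1 - X) * (inverse (1 + t2 / t1 * X) * inverse (1 + t1 / t2 * X)
         * inverse (1 + 1 / (t1 * t2) * X) * inverse (1 + t1 * t2 * X)))"
      by (metis mult.assoc mult.commute)
    moreover have "?S = (1 - X / of_nat q) * ((1 - X) * (inverse (1 + t2 / t1 * X) * inverse (1 + t1 / t2 * X)
         * inverse (1 + 1 / (t1 * t2) * X) * inverse (1 + t1 * t2 * X)))"
      by (simp add: divide_inverse mult.assoc)
    ultimately show ?thesis by (simp only:)
  qed
  ultimately show ?A ?B
    unfolding eq gen_fun_def by simp_all
qed

section \<open>Integration over the quotient\<close>

text \<open>Multiplication by \<open>p\<close> carries the units onto the shell through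
  \<open>p\<close>, so invariance transports their mass.\<close>

lemma haar_shell:
  fixes p :: "'f::local_field" and dm :: "'f measure"
  assumes dm: "haar_measure unit_group dm" "emeasure dm {x. absv x = 1} = 1" and p: "p \<noteq> 0"
  shows "{x. absv x = absv p} \<in> sets dm" "emeasure dm {x. absv x = absv p} = 1"
proof -
  have sets: "{x :: 'f. absv x = c} \<in> sets dm" if "c \<noteq> 0" for c
  proof -
    have "{x :: 'f. absv x = c} = {x. absv x = c} \<inter> {x. x \<noteq> 0}"
      using that by (auto simp: absv_0)
    moreover have "{x :: 'f. absv x = c} \<in> sets borel"
      by (rule borel_open) (rule open_absv_eq[OF that])
    ultimately show ?thesis
      using dm(1) by (auto simp: haar_measure_def unit_group_def sets_restrict_space)
  qed
  show "{x. absv x = absv p} \<in> sets dm"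
    using p by (intro sets) (simp add: absv_eq_0_iff)
  have "{x. absv x = absv p} = (\<lambda>x. p * x) ` {x. absv x = 1}"
  proof (intro equalityI subsetI)
    fix x :: 'f assume "x \<in> {x. absv x = absv p}"
    then show "x \<in> (\<lambda>x. p * x) ` {x. absv x = 1}"
      using p by (intro image_eqI[of _ _ "x / p"]) (auto simp: absv_divide absv_eq_0_iff)
  qed (auto simp: absv_mult)
  moreover have "emeasure dm ((\<lambda>x. p * x) ` {x. absv x = 1}) = emeasure dm {x. absv x = 1}"
    using dm(1) p sets[of 1] by (auto simp: haar_measure_def unit_group_def)
  ultimately show "emeasure dm {x. absv x = absv p} = 1"
    using dm(2) by simp
qed

text \<open>The sign is opposite to the usual one: \<open>n\<close> is the exponent in |u| = q^n, so
  that nonnegative \<open>n\<close> means integral 1/u.\<close>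

definition valuation :: "'f::local_field \<Rightarrow> int" where
  "valuation u = (THE n. absv u = real (resq TYPE('f)) powi n)"

lemma valuation_eq_iff:
  fixes u :: "'f::local_field"
  assumes "u \<noteq> 0"
  shows "valuation u = n \<longleftrightarrow> absv u = real (resq TYPE('f)) powi n"
proof -
  let ?q = "real (resq TYPE('f))"
  have q: "?q > 1" using resq_gt_1[where 'a = 'f] by simp
  obtain p0 :: 'f where "uniformizer p0"
    using uniformizer_exists by blast
  obtain m where "absv u = absv p0 powi m"
    using absv_eq_power[OF \<open>uniformizer p0\<close> assms] .
  then have m: "absv u = ?q powi (- m)"
    using absv_uniformizer[OF \<open>uniformizer p0\<close>] by (simp add: power_int_minus power_int_inverse divide_inverse)
  have "?q powi a = ?q powi b \<longleftrightarrow> a = b" for a b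
    using q power_int_strict_increasing[of a b ?q] power_int_strict_increasing[of b a ?q]
    by (metis less_irrefl linorder_neqE)
  then show ?thesis using m unfolding valuation_def by simp
qed

text \<open>All shells have mass 1 and there are countably many, so integrals of functions of |u|
  become sums over the integers.\<close>

lemma distr_valuation:
  fixes dm :: "'f::local_field measure"
  assumes dm: "haar_measure unit_group dm" "emeasure dm {x. absv x = 1} = 1"
  shows "valuation \<in> measurable dm (count_space UNIV)" "distr dm (count_space UNIV) valuation = count_space UNIV"
proof -
  obtain p0 :: 'f where p0: "uniformizer p0"
    using uniformizer_exists by blast
  have space: "space dm = {x. x \<noteq> 0}"
    using dm(1) by (simp add: haar_measure_def unit_group_def)
  have shell: "valuation -` {n} \<inter> space dm = {x. absv x = absv (p0 powi (- n))}" for n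
  proof -
    have "absv (p0 powi (- n)) = real (resq TYPE('f)) powi n"
      by (simp add: absv_power_int absv_inverse absv_uniformizer[OF p0] power_int_minus power_int_inverse divide_inverse)
    moreover have "real (resq TYPE('f)) powi n \<noteq> 0"
      using resq_gt_1[where 'a = 'f] by simp
    then have "x \<in> valuation -` {n} \<inter> space dm \<longleftrightarrow> absv x = real (resq TYPE('f)) powi n" for x
      by (cases "x = 0") (simp_all add: space valuation_eq_iff absv_0)
    ultimately show ?thesis by auto
  qed
  have nz: "p0 powi (- n) \<noteq> 0" for n using p0 by (simp add: uniformizer_def)
  show meas: "valuation \<in> measurable dm (count_space UNIV)"
    unfolding measurable_count_space_eq2_countable
    by (auto simp: shell haar_shell[OF dm nz])
  show "distr dm (count_space UNIV) valuation = count_space UNIV"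
    by (rule measure_eqI_countable[of _ UNIV])
       (simp_all add: emeasure_distr[OF meas] shell haar_shell[OF dm nz])
qed

text \<open>The translate of \<open>U\<close> by \<open>h\<close> is a neighbourhood of
  \<open>h\<close> on which \<Phi> is constant. It is written as a preimage under multiplication by
  the inverse of \<open>h\<close>, so continuity suffices.\<close>

lemma right_invariant_imp_openin:
  fixes \<Phi> :: "'f::local_field^4^4 \<Rightarrow> 'b"
  assumes "openin (top_of_set GSp4) U" "mat 1 \<in> U" "\<And>g h. g \<in> U \<Longrightarrow> h \<in> GSp4 \<Longrightarrow> \<Phi> (h ** g) = \<Phi> h"
  shows "openin (top_of_set GSp4) {h \<in> GSp4. \<Phi> h \<in> B}"
proof (subst openin_subopen, intro ballI)
  fix h :: "'f^4^4" assume h: "h \<in> {h \<in> GSp4. \<Phi> h \<in> B}"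
  then obtain h' where h': "h' \<in> GSp4" "h' ** h = mat 1" "h ** h' = mat 1"
    using GSp4_inverse by blast
  let ?T = "GSp4 \<inter> (\<lambda>x. h' ** x) -` U"
  have "openin (top_of_set GSp4) ?T"
    using GSp4_mult[OF h'(1)] by (intro continuous_openin_preimage[OF continuous_matrix_mult_left _ assms(1)]) auto
  moreover have "?T \<subseteq> {h \<in> GSp4. \<Phi> h \<in> B}"
  proof
    fix x assume x: "x \<in> ?T"
    have "h ** (h' ** x) = x" by (simp add: matrix_mul_assoc h')
    then have "\<Phi> x = \<Phi> h" using assms(3)[of "h' ** x" h] x h by simp
    then show "x \<in> {h \<in> GSp4. \<Phi> h \<in> B}" using x h by simp
  qed
  ultimately show "\<exists>T. openin (top_of_set GSp4) T \<and> h \<in> T \<and> T \<subseteq> {h \<in> GSp4. \<Phi> h \<in> B}"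
    using h h' assms(2) by (intro exI[of _ ?T]) auto
qed

lemma on_coset_eq:
  fixes \<Phi> :: "'f::local_field^4^4 \<Rightarrow> complex"
  assumes "\<And>g h. g \<in> GL2_NH \<Longrightarrow> h \<in> GSp4 \<Longrightarrow> \<Phi> (g ** h) = \<Phi> h" "h \<in> GSp4"
  shows "on_coset \<Phi> (GL2_NH #>\<^bsub>matrix_group GSp4\<^esub> h) = \<Phi> h"
proof -
  let ?C = "GL2_NH #>\<^bsub>matrix_group GSp4\<^esub> h"
  have "h \<in> ?C" using mat_1_GL2_NH by (force simp: r_coset_def matrix_group_def)
  then have "(SOME x. x \<in> ?C) \<in> ?C" by (rule someI)
  then show ?thesis using assms by (auto simp: on_coset_def r_coset_def matrix_group_def)
qed

lemma on_coset_measurable: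
  fixes \<Phi> :: "'f::local_field^4^4 \<Rightarrow> complex"
  assumes dh: "quotient_measure dh"
    and inv: "\<And>g h. g \<in> GL2_NH \<Longrightarrow> h \<in> GSp4 \<Longrightarrow> \<Phi> (g ** h) = \<Phi> h"
    and op: "\<And>B. openin (top_of_set GSp4) {h \<in> GSp4. \<Phi> h \<in> B}"
  shows "on_coset \<Phi> \<in> borel_measurable dh"
proof (rule measurableI)
  let ?G = "matrix_group GSp4 :: ('f^4^4) monoid"
  have sp: "space dh = rcosets\<^bsub>?G\<^esub> GL2_NH"
    and se: "sets dh = {A. A \<subseteq> rcosets\<^bsub>?G\<^esub> GL2_NH \<and> \<Union>A \<in> sets borel}"
    using dh by (simp_all add: quotient_measure_def Let_def)
  have coset: "C \<in> rcosets\<^bsub>?G\<^esub> GL2_NH \<longleftrightarrow> (\<exists>h\<in>GSp4. C = GL2_NH #>\<^bsub>?G\<^esub> h)" for C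
    by (auto simp: RCOSETS_def matrix_group_def)
  have mem: "x \<in> GL2_NH #>\<^bsub>?G\<^esub> h \<longleftrightarrow> (\<exists>g\<in>GL2_NH. x = g ** h)" for x h
    by (auto simp: r_coset_def matrix_group_def)
  have self: "h \<in> GL2_NH #>\<^bsub>?G\<^esub> h" for h
    using mat_1_GL2_NH by (force simp: mem)
  have union: "\<Union>{C \<in> rcosets\<^bsub>?G\<^esub> GL2_NH. on_coset \<Phi> C \<in> B} = {h \<in> GSp4. \<Phi> h \<in> B}" for B
  proof (intro equalityI subsetI)
    fix x assume "x \<in> \<Union>{C \<in> rcosets\<^bsub>?G\<^esub> GL2_NH. on_coset \<Phi> C \<in> B}"
    then obtain h g where h: "h \<in> GSp4" "on_coset \<Phi> (GL2_NH #>\<^bsub>?G\<^esub> h) \<in> B" "g \<in> GL2_NH" "x = g ** h"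
      unfolding coset by (auto simp: mem)
    then show "x \<in> {h \<in> GSp4. \<Phi> h \<in> B}"
      using on_coset_eq[of \<Phi> h] inv GSp4_mult[of g h] GL2_NH_GSp4[of g] by simp
  next
    fix x assume "x \<in> {h \<in> GSp4. \<Phi> h \<in> B}"
    then show "x \<in> \<Union>{C \<in> rcosets\<^bsub>?G\<^esub> GL2_NH. on_coset \<Phi> C \<in> B}"
      using on_coset_eq[of \<Phi> x, OF inv] self[of x] unfolding coset by auto
  qed
  \<comment> \<open>The whole quotient is measurable and its union is \<open>GSp4\<close>, which is
    thus a Borel set of matrices; relatively open sets in it are then Borel as well.\<close>
  have "space dh \<in> sets dh" by simp
  then have borel: "(GSp4 :: ('f^4^4) set) \<in> sets borel"
    using union[of UNIV] by (simp add: sp se)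
  fix B :: "complex set"
  obtain T where "open T" "{h \<in> GSp4. \<Phi> h \<in> B} = GSp4 \<inter> T"
    using op[of B] by (auto simp: openin_open)
  then have "{h \<in> GSp4. \<Phi> h \<in> B} \<in> sets borel"
    using borel by auto
  moreover have "on_coset \<Phi> -` B \<inter> space dh = {C \<in> rcosets\<^bsub>?G\<^esub> GL2_NH. on_coset \<Phi> C \<in> B}"
    by (auto simp: sp)
  ultimately show "on_coset \<Phi> -` B \<inter> space dh \<in> sets dh"
    using union[of B] by (simp add: se)
qed simp

lemma emeasure_distr_indicator:
  "g \<in> borel_measurable M \<Longrightarrow> B \<in> sets borel \<Longrightarrow> emeasure (distr M borel g) B = (\<integral>\<^sup>+x. indicator B (g x) \<partial>M)"
  using nn_integral_distr[of g M borel "indicator B"] by simp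

text \<open>The unfolding formula applies to indicator functions. It shows that the integrand under
  \<open>dh\<close> and \<open>c\<close> under the weighted counting measure have the same image
  measure, which yields integrability and the complex integral together.\<close>

lemma zeta_integral_unfold:
  fixes \<Phi> :: "'f::local_field^4^4 \<Rightarrow> complex" and c :: "int \<Rightarrow> complex"
  defines "q \<equiv> resq TYPE('f)"
  assumes dh: "quotient_measure dh"
    and inv: "\<And>g h. g \<in> GL2_NH \<Longrightarrow> h \<in> GSp4 \<Longrightarrow> \<Phi> (g ** h) = \<Phi> h"
    and op: "\<And>B. openin (top_of_set GSp4) {h \<in> GSp4. \<Phi> h \<in> B}"
    and val: "\<And>u k n. k \<in> GSp4_O \<Longrightarrow> absv u = real q powi n \<Longrightarrow> \<Phi> (m_mu u ** k) = c n"
  shows "integrable dh (on_coset \<Phi>) \<longleftrightarrow> integrable (count_space UNIV) (\<lambda>n. real q powi (3 * n) *\<^sub>R c n)"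
    and "(\<integral>C. on_coset \<Phi> C \<partial>dh) = (\<integral>n. real q powi (3 * n) *\<^sub>R c n \<partial>count_space UNIV)"
proof -
  let ?G = "matrix_group GSp4 :: ('f^4^4) monoid"
  define F where "F = on_coset \<Phi>"
  define W where "W n = real q powi (3 * n)" for n :: int
  have W: "W n \<ge> 0" for n by (simp add: W_def)
  have F: "F \<in> borel_measurable dh"
    unfolding F_def by (rule on_coset_measurable[OF dh inv op])
  obtain dk dm where dk: "haar_measure (matrix_group GSp4_O :: ('f^4^4) monoid) dk" "emeasure dk GSp4_O = 1"
    and dm: "haar_measure (unit_group :: 'f monoid) dm" "emeasure dm {x. absv x = 1} = 1"
    and unfold: "\<forall>\<Psi>\<in>borel_measurable dh. (\<integral>\<^sup>+C. \<Psi> C \<partial>dh) =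
       (\<integral>\<^sup>+u. ennreal (inverse (delta_PH (m_mu u))) * (\<integral>\<^sup>+k. \<Psi> (GL2_NH #>\<^bsub>?G\<^esub> (m_mu u ** k)) \<partial>dk) \<partial>dm)"
    using dh unfolding quotient_measure_def Let_def by (elim exE conjE) (rule that)
  note v = distr_valuation[OF dm]
  have space_dk: "space dk = GSp4_O" and space_dm: "space dm = {x. x \<noteq> 0}"
    using dk dm by (simp_all add: haar_measure_def matrix_group_def unit_group_def)
  let ?N = "density (count_space UNIV) (\<lambda>n. ennreal (W n))"
  have eq: "distr dh borel F = distr ?N borel c"
  proof (rule measure_eqI)
    fix B assume "B \<in> sets (distr dh borel F)"
    then have B[measurable]: "B \<in> sets borel" by simp
    have "emeasure (distr dh borel F) B = (\<integral>\<^sup>+C. indicator B (F C) \<partial>dh)"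
      using F B by (rule emeasure_distr_indicator)
    also have "\<dots> = (\<integral>\<^sup>+u. ennreal (inverse (delta_PH (m_mu u))) *
        (\<integral>\<^sup>+k. indicator B (F (GL2_NH #>\<^bsub>?G\<^esub> (m_mu u ** k))) \<partial>dk) \<partial>dm)"
      using F by (intro unfold[rule_format]) measurable
    also have "\<dots> = (\<integral>\<^sup>+u. ennreal (W (valuation u)) * indicator B (c (valuation u)) \<partial>dm)"
    proof (rule nn_integral_cong)
      fix u assume "u \<in> space dm"
      then have u: "u \<noteq> 0" by (simp add: space_dm)
      define n where "n = valuation u"
      have n: "absv u = real q powi n"
        using valuation_eq_iff[OF u, of n] by (simp add: n_def q_def)
      \<comment> \<open>The inverse modulus of \<open>m_mu u\<close> is |u|^3, the source of the
        weight q^(3n).\<close>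
      have d: "inverse (delta_PH (m_mu u)) = W n"
        by (simp add: delta_PH_m_mu W_def n mult.commute[of 3] power_int_mult power_inverse)
      have "(\<integral>\<^sup>+k. indicator B (F (GL2_NH #>\<^bsub>?G\<^esub> (m_mu u ** k))) \<partial>dk) = (\<integral>\<^sup>+k. indicator B (c n) \<partial>dk)"
      proof (rule nn_integral_cong)
        fix k assume "k \<in> space dk"
        then have k: "k \<in> GSp4_O" by (simp add: space_dk)
        then have "F (GL2_NH #>\<^bsub>?G\<^esub> (m_mu u ** k)) = \<Phi> (m_mu u ** k)"
          unfolding F_def using u by (intro on_coset_eq inv GSp4_mult m_mu_GSp4) (auto simp: GSp4_O_def)
        then show "indicator B (F (GL2_NH #>\<^bsub>?G\<^esub> (m_mu u ** k))) = indicator B (c n)"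
          using val[OF k n] by simp
      qed
      then show "ennreal (inverse (delta_PH (m_mu u))) *
          (\<integral>\<^sup>+k. indicator B (F (GL2_NH #>\<^bsub>?G\<^esub> (m_mu u ** k))) \<partial>dk)
        = ennreal (W (valuation u)) * indicator B (c (valuation u))"
        using dk(2) by (simp add: d space_dk flip: n_def)
    qed
    also have "\<dots> = (\<integral>\<^sup>+n. ennreal (W n) * indicator B (c n) \<partial>distr dm (count_space UNIV) valuation)"
      using v(1) by (subst nn_integral_distr) simp_all
    also have "\<dots> = (\<integral>\<^sup>+n. indicator B (c n) \<partial>?N)"
      unfolding v(2) by (subst nn_integral_density) simp_all
    also have "\<dots> = emeasure (distr ?N borel c) B"
      by (rule emeasure_distr_indicator[symmetric]) simp_all
    finally show "emeasure (distr dh borel F) B = emeasure (distr ?N borel c) B" .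
  qed simp
  have "integrable dh F \<longleftrightarrow> integrable (distr dh borel F) (\<lambda>x. x)"
    using F by (simp add: integrable_distr_eq)
  also have "\<dots> \<longleftrightarrow> integrable ?N c"
    unfolding eq by (simp add: integrable_distr_eq)
  also have "\<dots> \<longleftrightarrow> integrable (count_space UNIV) (\<lambda>n. W n *\<^sub>R c n)"
    by (rule integrable_density) (simp_all add: W)
  finally show "integrable dh (on_coset \<Phi>) \<longleftrightarrow> integrable (count_space UNIV) (\<lambda>n. real q powi (3 * n) *\<^sub>R c n)"
    by (simp add: F_def W_def)
  have "(\<integral>C. F C \<partial>dh) = (\<integral>x. x \<partial>distr dh borel F)"
    using F by (simp add: integral_distr)
  also have "\<dots> = (\<integral>n. c n \<partial>?N)"
    unfolding eq by (simp add: integral_distr)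
  also have "\<dots> = (\<integral>n. W n *\<^sub>R c n \<partial>count_space UNIV)"
    by (rule integral_density) (simp_all add: W)
  finally show "(\<integral>C. on_coset \<Phi> C \<partial>dh) = (\<integral>n. real q powi (3 * n) *\<^sub>R c n \<partial>count_space UNIV)"
    by (simp add: F_def W_def)
qed

text \<open>Integrability for a counting measure is absolute summability; with nothing at negative
  indices, the integers reduce to the naturals.\<close>

lemma integral_count_space_int:
  fixes g :: "int \<Rightarrow> complex"
  assumes "\<And>n. n < 0 \<Longrightarrow> g n = 0" "summable (\<lambda>n. norm (g (int n)))" "(\<lambda>n. g (int n)) sums S"
  shows "integrable (count_space UNIV) g" "(\<integral>n. g n \<partial>count_space UNIV) = S"
proof -
  have out: "g n = 0" if "n \<notin> range int" for n
    using that assms(1)[of n] by (metis nonneg_int_cases not_less rangeI)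
  have nat: "Infinite_Set_Sum.abs_summable_on (\<lambda>n. g (int n)) UNIV"
    using assms(2) by (simp add: abs_summable_on_nat_iff')
  have "Infinite_Set_Sum.abs_summable_on g UNIV \<longleftrightarrow> Infinite_Set_Sum.abs_summable_on g (range int)"
    by (rule abs_summable_on_cong_neutral) (auto intro: out)
  moreover have "\<dots>"
    using nat by (rule Infinite_Set_Sum.abs_summable_on_reindex)
  ultimately have "Infinite_Set_Sum.abs_summable_on g UNIV" by blast
  then show "integrable (count_space UNIV) g"
    by (simp add: Infinite_Set_Sum.abs_summable_on_def)
  have "infsetsum g UNIV = infsetsum g (range int)"
    by (rule infsetsum_cong_neutral) (auto intro: out)
  also have "\<dots> = infsetsum (\<lambda>n. g (int n)) UNIV"
    by (rule infsetsum_reindex) auto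
  also have "\<dots> = S"
    using infsetsum_nat'[OF nat] assms(3) by (simp add: sums_iff)
  finally show "(\<integral>n. g n \<partial>count_space UNIV) = S"
    by (simp add: infsetsum_def)
qed

section \<open>The zeta integral\<close>

lemma invertible_mat_1: "invertible (mat 1)"
  by (auto simp: invertible_def)

lemma hstar_mat_1: "hstar (mat 1) = (mat 1 :: 'a::field^4^4)"
  unfolding hstar_eq[OF invertible_mat_1]
  by (simp add: vec_eq_iff forall_4 block_nth mat2_nth mat_def)

text \<open>The base is a positive real, so the principal logarithm is the real one and the
  exponents 3 and (s + 1)/3 may be multiplied without a branch correction.\<close>

lemma of_real_power_powr:
  fixes q :: real and s :: complex
  assumes "q > 0"
  shows "of_real (inverse (q powi int n) ^ 3) powr ((s + 1) / 3) = (of_real q powr (- (s + 1))) ^ n"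
proof -
  have "inverse (q powi int n) ^ 3 = exp (- (3 * real n * ln q))"
  proof -
    have "exp (real (3 * n) * ln q) = q ^ (3 * n)"
      using assms by (simp only: exp_of_nat_mult exp_ln)
    then show ?thesis by (simp add: exp_minus power_inverse mult.commute flip: power_mult)
  qed
  then have "of_real (inverse (q powi int n) ^ 3) powr ((s + 1) / 3) = exp ((s + 1) / 3 * of_real (- (3 * real n * ln q)))"
    by (simp only: powr_def of_real_eq_0_iff exp_not_eq_zero if_False Ln_of_real[OF exp_gt_zero] ln_exp)
  also have "\<dots> = exp (of_nat n * (- (s + 1) * of_real (ln q)))"
    by (rule arg_cong[where f = exp]) (simp add: field_simps)
  also have "\<dots> = (of_real q powr (- (s + 1))) ^ n"
    using assms by (simp only: exp_of_nat_mult powr_def Ln_of_real) simp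
  finally show ?thesis .
qed

section \<open>The spherical Shalika function and its integral\<close>

locale spherical_shalika = unramified_quadratic_ext \<iota> cj \<delta>
  for \<iota> :: "'f::local_field \<Rightarrow> 'e::local_field" and cj :: "'e \<Rightarrow> 'e" and \<delta> :: 'e +
  fixes \<psi> :: "'f \<Rightarrow> complex" and sc :: "complex \<Rightarrow> 'v::ab_group_add \<Rightarrow> 'v"
    and \<Pi>\<^sub>G :: "'e^4^4 \<Rightarrow> 'v \<Rightarrow> 'v" and \<Lambda> :: "'v \<Rightarrow> complex" and \<phi>\<^sub>0 :: 'v
  assumes psi: "additive_character \<psi>" "shalika_character_unramified \<iota> cj \<delta> \<psi>"
    and smooth: "smooth_rep (matrix_group (GU \<iota> cj)) sc UNIV \<Pi>\<^sub>G"
    and central: "\<And>z v. z \<noteq> 0 \<Longrightarrow> \<Pi>\<^sub>G (mat z) v = v"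
    and spherical: "\<And>k. k \<in> GU_O \<iota> cj \<Longrightarrow> \<Pi>\<^sub>G k \<phi>\<^sub>0 = \<phi>\<^sub>0"
    and Lambda: "shalika_functional \<iota> cj \<delta> \<psi> sc \<Pi>\<^sub>G \<Lambda>"
begin

lemma action_mult: "g \<in> GU \<iota> cj \<Longrightarrow> h \<in> GU \<iota> cj \<Longrightarrow> \<Pi>\<^sub>G (g ** h) v = \<Pi>\<^sub>G g (\<Pi>\<^sub>G h v)"
  using smooth by (simp add: smooth_rep_def matrix_group_def)

lemma action_one: "\<Pi>\<^sub>G (mat 1) v = v"
  using smooth by (simp add: smooth_rep_def matrix_group_def)

lemma Lambda_shalika:
  "invertible h \<Longrightarrow> \<Lambda> (\<Pi>\<^sub>G (map_matrix \<iota> (hstar h) ** siegel_unip a (\<iota> x) (\<iota> y) (cj a)) v)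
     = \<psi> (toF \<iota> (\<delta> * a - \<delta> * cj a)) * \<Lambda> v"
  using Lambda by (auto simp: shalika_functional_def)

lemma Lambda_siegel_unip: "\<Lambda> (\<Pi>\<^sub>G (siegel_unip a 0 0 (cj a)) v) = \<psi> (toF \<iota> (\<delta> * a - \<delta> * cj a)) * \<Lambda> v"
  using Lambda_shalika[OF invertible_mat_1, of a 0 0 v]
  by (simp add: hstar_mat_1 map_\<iota>_mat \<iota>_one \<iota>_0)

text \<open>The off-diagonal entry lies in F and is fixed by conjugation, so the Shalika character
  is evaluated at 0. Hence the integrand descends to cosets.\<close>

lemma Lambda_GL2_NH:
  assumes "g \<in> GL2_NH" "h \<in> GSp4"
  shows "\<Lambda> (\<Pi>\<^sub>G (map_matrix \<iota> (g ** h)) v) = \<Lambda> (\<Pi>\<^sub>G (map_matrix \<iota> h) v)"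
proof -
  obtain h' :: "'f^2^2" and a x y where h': "invertible h'" "g = hstar h' ** siegel_unip a x y a"
    using assms(1) by (rule GL2_NH_cases)
  have "map_matrix \<iota> (siegel_unip a x y a) = siegel_unip (\<iota> a) (\<iota> x) (\<iota> y) (cj (\<iota> a))"
    by (simp add: siegel_unip_def map_matrix_block map_\<iota>_mat \<iota>_one cj_\<iota>)
       (simp add: vec_eq_iff forall_4 block_nth mat2_nth \<iota>_0)
  then have g: "map_matrix \<iota> g = map_matrix \<iota> (hstar h') ** siegel_unip (\<iota> a) (\<iota> x) (\<iota> y) (cj (\<iota> a))"
    by (simp add: h' map_\<iota>_mult)
  have "\<psi> 0 * \<psi> 0 = \<psi> 0" "\<psi> 0 \<noteq> 0"
    using psi(1) unfolding additive_character_def by (metis add_0, metis norm_zero zero_neq_one)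
  then have "\<psi> 0 = 1" by simp
  then have "\<Lambda> (\<Pi>\<^sub>G (map_matrix \<iota> g) w) = \<Lambda> w" for w
    unfolding g Lambda_shalika[OF h'(1)] by (simp add: cj_\<iota> toF_\<iota>[of 0, unfolded \<iota>_0])
  then show ?thesis
    using assms by (simp add: map_\<iota>_mult action_mult map_\<iota>_GU GL2_NH_GSp4)
qed

lemma openin_stabilizer:
  "openin (top_of_set GSp4) {g \<in> GSp4. \<Pi>\<^sub>G (map_matrix \<iota> g) v = v}"
proof -
  have "openin (top_of_set (GU \<iota> cj)) {g \<in> GU \<iota> cj. \<Pi>\<^sub>G g v = v}"
    using smooth by (simp add: smooth_rep_def matrix_group_def)
  then have "openin (top_of_set GSp4) (GSp4 \<inter> map_matrix \<iota> -` {g \<in> GU \<iota> cj. \<Pi>\<^sub>G g v = v})"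
    by (intro continuous_openin_preimage[OF continuous_map_\<iota>]) (auto simp: map_\<iota>_GU)
  moreover have "GSp4 \<inter> map_matrix \<iota> -` {g \<in> GU \<iota> cj. \<Pi>\<^sub>G g v = v} = {g \<in> GSp4. \<Pi>\<^sub>G (map_matrix \<iota> g) v = v}"
    using map_\<iota>_GU by auto
  ultimately show ?thesis by simp
qed

lemma similitude_dilation_\<iota>: "similitude cj (dilation (\<iota> z)) (\<iota> z)"
  by (rule similitude_dilation) (simp_all add: cj_0 cj_one cj_\<iota>)

lemma dilation_GU: "z \<noteq> 0 \<Longrightarrow> dilation (\<iota> z) \<in> GU \<iota> cj"
  using similitude_dilation_\<iota> by (rule GUI)

lemma dilation_GU_O: "absv e = 1 \<Longrightarrow> dilation (\<iota> e) \<in> GU_O \<iota> cj"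
proof (rule GU_OI[OF similitude_dilation_\<iota>])
  assume "absv e = 1"
  then have "\<forall>i j. absv (dilation (\<iota> e) $ i $ j) \<le> 1"
    by (simp add: dilation_def forall_4 block_nth mat_def absv_0 absv_1 absv_\<iota>)
  then show "absv (dilation (\<iota> e) $ i $ j) \<le> 1" for i j by blast
qed

lemma siegel_unip_GU: "siegel_unip a 0 0 (cj a) \<in> GU \<iota> cj"
  by (rule GUI[of _ 1]) (simp_all add: \<iota>_one cj_0 cj_one cj_cj similitude_siegel_unip)

lemma siegel_unip_GU_O:
  assumes "absv a \<le> 1"
  shows "siegel_unip a 0 0 (cj a) \<in> GU_O \<iota> cj"
proof (rule GU_OI[of _ 1])
  show "similitude cj (siegel_unip a 0 0 (cj a)) (\<iota> 1)"
    by (simp add: \<iota>_one cj_0 cj_one cj_cj similitude_siegel_unip)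
  have "\<forall>i j. absv (siegel_unip a 0 0 (cj a) $ i $ j) \<le> 1"
    using assms by (simp add: siegel_unip_def forall_4 block_nth mat2_nth mat_def absv_0 absv_1 absv_cj)
  then show "absv (siegel_unip a 0 0 (cj a) $ i $ j) \<le> 1" for i j by blast
qed (simp add: absv_1)

text \<open>The integral \<open>k\<close> fixes the spherical vector and the scalar \<open>u\<close>
  acts trivially, which leaves the dilation.\<close>

lemma Lambda_m_mu:
  assumes "u \<noteq> 0" "k \<in> GSp4_O"
  shows "\<Lambda> (\<Pi>\<^sub>G (map_matrix \<iota> (m_mu u ** k)) \<phi>\<^sub>0) = \<Lambda> (\<Pi>\<^sub>G (dilation (\<iota> (inverse u))) \<phi>\<^sub>0)"
proof -
  have k: "k \<in> GSp4" using assms(2) by (simp add: GSp4_O_def)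
  have d: "map_matrix \<iota> (dilation (inverse u)) = dilation (\<iota> (inverse u))"
    by (simp add: dilation_def map_matrix_block map_\<iota>_mat \<iota>_one)
       (simp add: vec_eq_iff forall_4 block_nth \<iota>_0)
  have "\<Pi>\<^sub>G (map_matrix \<iota> (m_mu u ** k)) \<phi>\<^sub>0 = \<Pi>\<^sub>G (map_matrix \<iota> (m_mu u)) \<phi>\<^sub>0"
    using assms k by (simp add: map_\<iota>_mult action_mult map_\<iota>_GU m_mu_GSp4 spherical map_\<iota>_GU_O)
  also have "map_matrix \<iota> (m_mu u) = mat (\<iota> u) ** dilation (\<iota> (inverse u))"
    using assms(1) by (simp add: m_mu_eq_dilation map_\<iota>_mult map_\<iota>_mat d)
  also have "\<Pi>\<^sub>G \<dots> \<phi>\<^sub>0 = \<Pi>\<^sub>G (dilation (\<iota> (inverse u))) \<phi>\<^sub>0"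
    using assms(1) by (subst action_mult) (simp_all add: mat_GU dilation_GU central \<iota>_eq_0_iff)
  finally show ?thesis by simp
qed

lemma Lambda_dilation_unit:
  assumes "z \<noteq> 0" "absv e = 1"
  shows "\<Lambda> (\<Pi>\<^sub>G (dilation (\<iota> (z * e))) \<phi>\<^sub>0) = \<Lambda> (\<Pi>\<^sub>G (dilation (\<iota> z)) \<phi>\<^sub>0)"
proof -
  have "e \<noteq> 0" using assms(2) by (auto simp: absv_0)
  then show ?thesis
    using assms by (simp add: \<iota>_mult dilation_mult action_mult dilation_GU spherical dilation_GU_O)
qed

text \<open>Moving an integral unipotent element across \<open>dilation (\<iota> z)\<close> rescales its argument by \<open>z\<close>,
  where the character is nontrivial once \<open>z\<close> is not integral.\<close>

lemma Lambda_dilation_eq_0: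
  assumes "absv z > 1"
  shows "\<Lambda> (\<Pi>\<^sub>G (dilation (\<iota> z)) \<phi>\<^sub>0) = 0"
proof -
  obtain p :: 'f where p: "uniformizer p" using uniformizer_exists by blast
  \<comment> \<open>As E is unramified, \<open>\<iota> p\<close> is a uniformizer of E, so the
    conductor provides \<open>a\<close> with \<open>\<iota> p * a\<close> integral. Since |z| > 1
    forces |1/z| <= |p|, this single \<open>a\<close> becomes integral after division by any such
    \<open>z\<close>.\<close>
  obtain a where a: "absv (\<iota> p * a) \<le> 1" "\<psi> (toF \<iota> (\<delta> * a - \<delta> * cj a)) \<noteq> 1"
    using psi(2) unramified[OF p] unfolding shalika_character_unramified_def by blast
  have z: "z \<noteq> 0" using assms by (auto simp: absv_0)
  have "absv (inverse z) \<le> absv p"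
  proof -
    have "absv (inverse z) < 1"
      using assms by (simp add: absv_inverse inverse_less_1_iff)
    then show ?thesis using p by (simp add: uniformizer_def)
  qed
  then have "absv (\<iota> (inverse z)) \<le> absv (\<iota> p)"
    unfolding absv_\<iota> by (intro power_mono absv_nonneg)
  then have "absv (\<iota> (inverse z) * a) \<le> absv (\<iota> p * a)"
    unfolding absv_mult by (intro mult_right_mono absv_nonneg)
  define b where "b = \<iota> (inverse z) * a"
  have "\<iota> z * \<iota> (inverse z) = 1" using z by (simp add: \<iota>_inverse \<iota>_eq_0_iff)
  then have b: "absv b \<le> 1" "\<iota> z * b = a" "\<iota> z * cj b = cj a"
    using \<open>absv (\<iota> (inverse z) * a) \<le> absv (\<iota> p * a)\<close> a z
    by (simp_all add: b_def cj_mult cj_\<iota> flip: mult.assoc)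
  have "\<Pi>\<^sub>G (dilation (\<iota> z)) \<phi>\<^sub>0 = \<Pi>\<^sub>G (dilation (\<iota> z)) (\<Pi>\<^sub>G (siegel_unip b 0 0 (cj b)) \<phi>\<^sub>0)"
    using b by (simp add: spherical siegel_unip_GU_O)
  also have "\<dots> = \<Pi>\<^sub>G (dilation (\<iota> z) ** siegel_unip b 0 0 (cj b)) \<phi>\<^sub>0"
    using z by (simp add: action_mult dilation_GU siegel_unip_GU)
  also have "\<dots> = \<Pi>\<^sub>G (siegel_unip a 0 0 (cj a)) (\<Pi>\<^sub>G (dilation (\<iota> z)) \<phi>\<^sub>0)"
    using z by (simp add: dilation_siegel_unip b action_mult dilation_GU siegel_unip_GU)
  finally have "\<Lambda> (\<Pi>\<^sub>G (dilation (\<iota> z)) \<phi>\<^sub>0) = \<psi> (toF \<iota> (\<delta> * a - \<delta> * cj a)) * \<Lambda> (\<Pi>\<^sub>G (dilation (\<iota> z)) \<phi>\<^sub>0)"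
    using Lambda_siegel_unip by metis
  then show ?thesis using a(2) by simp
qed

lemma zeta_integral:
  fixes f :: "'f^4^4 \<Rightarrow> complex" and dh :: "('f^4^4) set measure" and p :: 'f
  defines "q \<equiv> resq TYPE('f)"
  assumes p: "uniformizer p" and t: "t1 \<noteq> 0" "t2 \<noteq> 0"
    and val: "\<And>n. \<Lambda> (\<Pi>\<^sub>G (dilation (\<iota> p ^ n)) \<phi>\<^sub>0) = shalika_value q t1 t2 n"
    and dh: "quotient_measure dh"
    and f: "f \<in> section_space s"
      "\<And>k. k \<in> GSp4_O \<Longrightarrow> f k = zetaF TYPE('f) (s + 1) * zetaF TYPE('f) (2 * s)"
    and s: "\<And>w. w \<in> set (std_weights t1 t2) \<Longrightarrow> norm w < real q powr Re s"
  shows "integrable dh (on_coset (\<lambda>h. f h * \<Lambda> (\<Pi>\<^sub>G (map_matrix \<iota> h) \<phi>\<^sub>0)))"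
    and "(\<integral>C. on_coset (\<lambda>h. f h * \<Lambda> (\<Pi>\<^sub>G (map_matrix \<iota> h) \<phi>\<^sub>0)) C \<partial>dh) = L_std_twisted q t1 t2 s"
proof -
  define \<Phi> where "\<Phi> h = f h * \<Lambda> (\<Pi>\<^sub>G (map_matrix \<iota> h) \<phi>\<^sub>0)" for h
  define Z where "Z = zetaF TYPE('f) (s + 1) * zetaF TYPE('f) (2 * s)"
  define X :: complex where "X = of_nat q powr (- s)"
  \<comment> \<open>\<open>n\<close> is the exponent in |u| = q^n, so \<open>nat n\<close> is the
    power of \<open>p\<close> in 1/u; the value 0 at negative \<open>n\<close> comes from the
    vanishing at non-integral dilations.\<close>
  define c where "c n = (if n < 0 then 0 else
    (of_nat q powr (- (s + 1))) ^ nat n * Z * shalika_value q t1 t2 (nat n))" for n :: int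
  have q: "q > 1" using resq_gt_1[where 'a = 'f] by (simp add: q_def)
  have p0: "p \<noteq> 0" "absv p = inverse (real q)"
    using p absv_uniformizer[OF p] by (simp_all add: uniformizer_def q_def inverse_eq_divide)
  have inv: "\<Phi> (g ** h) = \<Phi> h" if "g \<in> GL2_NH" "h \<in> GSp4" for g h
    using that f(1) by (simp add: \<Phi>_def section_left_invariant Lambda_GL2_NH)
  have op: "openin (top_of_set GSp4) {h \<in> GSp4. \<Phi> h \<in> B}" for B
  proof (rule right_invariant_imp_openin)
    let ?G = "matrix_group GSp4 :: ('f^4^4) monoid"
    \<comment> \<open>The common stabilizer of the section and the spherical vector, open because
      both are smooth.\<close>
    let ?U = "{g \<in> GSp4. rtrans ?G g f = f} \<inter> {g \<in> GSp4. \<Pi>\<^sub>G (map_matrix \<iota> g) \<phi>\<^sub>0 = \<phi>\<^sub>0}"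
    have "openin (top_of_set GSp4) {g \<in> GSp4. rtrans ?G g f = f}" and f0: "\<And>x. x \<notin> GSp4 \<Longrightarrow> f x = 0"
      using f(1) by (simp_all add: section_space_def smooth_ind_def matrix_group_def)
    then show "openin (top_of_set GSp4) ?U"
      using openin_stabilizer by (intro openin_Int)
    have "rtrans ?G (mat 1) f = f"
      using f0 by (simp add: rtrans_def matrix_group_def fun_eq_iff)
    then show "mat 1 \<in> ?U"
      by (simp add: mat_1_GSp4 map_\<iota>_mat \<iota>_one action_one)
    show "\<Phi> (h ** g) = \<Phi> h" if "g \<in> ?U" "h \<in> GSp4" for g h
    proof -
      have "rtrans ?G g f h = f h" using that by simp
      then have "f (h ** g) = f h" using that by (simp add: rtrans_def matrix_group_def)
      then show ?thesis using that by (simp add: \<Phi>_def map_\<iota>_mult action_mult map_\<iota>_GU)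
    qed
  qed
  have c: "\<Phi> (m_mu u ** k) = c n" if k: "k \<in> GSp4_O" and u: "absv u = real q powi n" for u k n
  proof -
    have nz: "u \<noteq> 0" using u q by (auto simp: absv_0)
    have "k \<in> GSp4" using k by (simp add: GSp4_O_def)
    then have \<Phi>: "\<Phi> (m_mu u ** k) =
        of_real (inverse (absv u) ^ 3) powr ((s + 1) / 3) * Z * \<Lambda> (\<Pi>\<^sub>G (dilation (\<iota> (inverse u))) \<phi>\<^sub>0)"
      using f k nz by (simp add: \<Phi>_def section_m_mu Lambda_m_mu Z_def del: of_real_power)
    show ?thesis
    proof (cases "n < 0")
      case True
      have "real q powi n < real q powi 0"
        using True q by (intro power_int_strict_increasing) auto
      moreover have "real q powi n > 0" using q by simp
      ultimately have "absv (inverse u) > 1"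
        using u by (simp add: absv_inverse one_less_inverse_iff)
      then show ?thesis using True unfolding \<Phi> by (simp add: Lambda_dilation_eq_0 c_def)
    next
      case False
      then obtain m where m: "n = int m" by (metis nonneg_int_cases not_less)
      \<comment> \<open>The unit by which 1/u differs from p^m; it is absorbed by the spherical
        vector.\<close>
      define e where "e = inverse u / p ^ m"
      have "absv e = 1"
        using u q p0 by (simp add: e_def m absv_divide absv_inverse absv_power power_inverse)
      moreover have "inverse u = p ^ m * e" using p0 by (simp add: e_def)
      ultimately have "\<Lambda> (\<Pi>\<^sub>G (dilation (\<iota> (inverse u))) \<phi>\<^sub>0) = shalika_value q t1 t2 m"
        using Lambda_dilation_unit[of "p ^ m" e] p0 val[of m] by (simp add: \<iota>_power)
      then show ?thesis
        using of_real_power_powr[of "real q" m s] q unfolding \<Phi> u by (simp add: c_def m)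
    qed
  qed
  note unfold = zeta_integral_unfold[of dh \<Phi> c, folded q_def, OF dh inv op c]
  have X: "norm X < 1"
  proof -
    have "norm X = real q powr - Re s"
      using q norm_powr_real_powr[of "of_nat q" "- s"] by (simp add: X_def)
    then show ?thesis using s[of 1] by (simp add: std_weights_def powr_minus inverse_less_1_iff)
  qed
  have X1: "of_nat q powr (- s - 1) = X / of_nat q"
    using q by (simp add: X_def powr_diff)
  \<comment> \<open>The weight q^(3n) and the section factor (X/q)^n combine to q^(2n) X^n, the
    shape of the series already summed.\<close>
  have g: "real q powi (3 * int n) *\<^sub>R c (int n) = Z * (shalika_value q t1 t2 n * of_nat q ^ (2 * n) * X ^ n)" for n
  proof -
    have "real q powi (3 * int n) *\<^sub>R c (int n) =
        Z * (shalika_value q t1 t2 n * ((of_nat q ^ 3) ^ n * (X / of_nat q) ^ n))"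
      by (simp add: c_def X1 scaleR_conv_of_real power_int_mult power_int_def nat_mult_distrib flip: power_mult)
    also have "(of_nat q ^ 3) ^ n * (X / of_nat q) ^ n = (of_nat q ^ 2 * X) ^ n"
      using q unfolding power_mult_distrib[symmetric] by (simp add: eval_nat_numeral mult.assoc)
    finally show ?thesis by (simp add: power_mult_distrib power_mult mult.assoc)
  qed
  note ser = shalika_series[OF t q s, folded X_def]
  \<comment> \<open>\<zeta>(2s) inverts 1 - X^2 and \<zeta>(s + 1) inverts 1 - X/q; neither factor
    vanishes, as |X| < 1.\<close>
  have Z: "Z * ((1 - X\<^sup>2) * (1 - X / of_nat q)) = 1"
  proof -
    have 2: "of_nat q powr (- (2 * s)) = X\<^sup>2"
      by (simp add: X_def powr_def power2_eq_square mult.assoc flip: exp_add)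
    have "norm (X\<^sup>2) < 1"
      using X by (simp add: norm_power power_less_one_iff)
    moreover have "norm (X / of_nat q) < 1"
      using X q by (simp add: norm_divide field_simps)
    ultimately have "1 - X\<^sup>2 \<noteq> 0" "1 - X / of_nat q \<noteq> 0"
      by (metis eq_iff_diff_eq_0 less_irrefl norm_one)+
    then show ?thesis
      by (simp add: Z_def zetaF_def X1 2 flip: q_def)
  qed
  have "Z * ((1 - X\<^sup>2) * (1 - X / of_nat q) * L_std_twisted q t1 t2 s) = L_std_twisted q t1 t2 s"
    using Z by (metis mult.assoc mult_1)
  then have "(\<lambda>n. Z * (shalika_value q t1 t2 n * of_nat q ^ (2 * n) * X ^ n)) sums L_std_twisted q t1 t2 s"
    using sums_mult[OF ser(2), of Z] by (simp only:)
  moreover have "summable (\<lambda>n. norm (Z * (shalika_value q t1 t2 n * of_nat q ^ (2 * n) * X ^ n)))"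
    unfolding norm_mult[of Z] by (rule summable_mult[OF ser(1)])
  ultimately have "integrable (count_space UNIV) (\<lambda>n. real q powi (3 * n) *\<^sub>R c n)"
    "(\<integral>n. real q powi (3 * n) *\<^sub>R c n \<partial>count_space UNIV) = L_std_twisted q t1 t2 s"
    by (intro integral_count_space_int; simp add: g; simp add: c_def)+
  then show "integrable dh (on_coset (\<lambda>h. f h * \<Lambda> (\<Pi>\<^sub>G (map_matrix \<iota> h) \<phi>\<^sub>0)))"
    and "(\<integral>C. on_coset (\<lambda>h. f h * \<Lambda> (\<Pi>\<^sub>G (map_matrix \<iota> h) \<phi>\<^sub>0)) C \<partial>dh) = L_std_twisted q t1 t2 s"
    using unfold by (simp_all add: \<Phi>_def[abs_def])
qed

end

theorem theorem6p5:
  fixes \<iota> :: "'f::local_field \<Rightarrow> 'e::local_field" and cj :: "'e \<Rightarrow> 'e" and \<delta> :: 'e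
    and \<psi> \<chi>\<^sub>1 \<chi>\<^sub>2 \<chi>\<^sub>0 :: "'f \<Rightarrow> complex" and p :: 'f
    and sc :: "complex \<Rightarrow> 'w::ab_group_add \<Rightarrow> 'w" and \<pi> :: "'f^4^4 \<Rightarrow> 'w \<Rightarrow> 'w"
    and sc' :: "complex \<Rightarrow> 'v::ab_group_add \<Rightarrow> 'v" and \<Pi>\<^sub>G :: "'e^4^4 \<Rightarrow> 'v \<Rightarrow> 'v"
    and \<Lambda> :: "'v \<Rightarrow> complex" and \<phi>\<^sub>0 :: 'v
    and q :: nat and t1 t2 s :: complex
    and f :: "'f^4^4 \<Rightarrow> complex" and dh :: "('f^4^4) set measure"
  defines "q \<equiv> resq TYPE('f)"
    and "t1 \<equiv> \<chi>\<^sub>1 p * \<chi>\<^sub>2 p * \<chi>\<^sub>0 p"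
    and "t2 \<equiv> \<chi>\<^sub>1 p * \<chi>\<^sub>0 p"
  assumes ext: "unramified_quadratic_ext \<iota> cj \<delta>"
    and p: "uniformizer p"
    and psi: "additive_character \<psi>" "\<exists>x. \<psi> x \<noteq> 1" "shalika_character_unramified \<iota> cj \<delta> \<psi>"
    and chi: "unramified_character \<chi>\<^sub>1" "unramified_character \<chi>\<^sub>2" "unramified_character \<chi>\<^sub>0"
    and central: "\<And>x. x \<noteq> 0 \<Longrightarrow> \<chi>\<^sub>1 x * \<chi>\<^sub>2 x * (\<chi>\<^sub>0 x)\<^sup>2 = 1"
    and regular: "\<And>\<eta>. \<eta> \<in> {\<chi>\<^sub>1, \<chi>\<^sub>2, \<lambda>x. \<chi>\<^sub>1 x * \<chi>\<^sub>2 x, \<lambda>x. \<chi>\<^sub>1 x * inverse (\<chi>\<^sub>2 x)} \<Longrightarrow>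
        \<not> (\<forall>x. x \<noteq> 0 \<longrightarrow> \<eta> x = of_real (absv x)) \<and>
        \<not> (\<forall>x. x \<noteq> 0 \<longrightarrow> \<eta> x = of_real (inverse (absv x)))"
    and pi: "irreducible_constituent (matrix_group (GSp4_plus \<iota> cj))
        fscale (I_H \<chi>\<^sub>1 \<chi>\<^sub>2 \<chi>\<^sub>0) (rtrans (matrix_group GSp4)) sc UNIV \<pi>"
      "psi_generic \<psi> sc \<pi>"
    and Pi: "smooth_rep (matrix_group (GU \<iota> cj)) sc' UNIV \<Pi>\<^sub>G"
      "\<And>z v. z \<noteq> 0 \<Longrightarrow> \<Pi>\<^sub>G (mat z) v = v"
      "irreducible_rep (matrix_group (GU \<iota> cj)) sc' UNIV \<Pi>\<^sub>G"
      "generic_GU \<iota> cj \<psi> sc' \<Pi>\<^sub>G"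
      "small_theta_lift \<iota> cj \<delta> \<psi> sc \<pi> sc' \<Pi>\<^sub>G"
    and spherical: "\<phi>\<^sub>0 \<noteq> 0" "\<And>k. k \<in> GU_O \<iota> cj \<Longrightarrow> \<Pi>\<^sub>G k \<phi>\<^sub>0 = \<phi>\<^sub>0"
    and Lambda: "shalika_functional \<iota> cj \<delta> \<psi> sc' \<Pi>\<^sub>G \<Lambda>"
      "\<And>n. \<Lambda> (\<Pi>\<^sub>G (block (mat (\<iota> p ^ n)) 0 0 (mat 1)) \<phi>\<^sub>0) = shalika_value q t1 t2 n"
    and dh: "quotient_measure dh"
    and f: "f \<in> section_space s"
      "\<And>k. k \<in> GSp4_O \<Longrightarrow> f k = zetaF TYPE('f) (s + 1) * zetaF TYPE('f) (2 * s)"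
    and s: "\<And>w. w \<in> set (std_weights t1 t2) \<Longrightarrow> norm w < real q powr Re s"
  shows "integrable dh (on_coset (\<lambda>h. f h * \<Lambda> (\<Pi>\<^sub>G (map_matrix \<iota> h) \<phi>\<^sub>0))) \<and>
    (\<integral>C. on_coset (\<lambda>h. f h * \<Lambda> (\<Pi>\<^sub>G (map_matrix \<iota> h) \<phi>\<^sub>0)) C \<partial>dh) = L_std_twisted q t1 t2 s"
proof -
  have "p \<noteq> 0" using p by (simp add: uniformizer_def)
  then have t: "t1 \<noteq> 0" "t2 \<noteq> 0"
    using chi by (simp_all add: t1_def t2_def unramified_character_def)
  have val: "\<Lambda> (\<Pi>\<^sub>G (dilation (\<iota> p ^ n)) \<phi>\<^sub>0) = shalika_value (resq TYPE('f)) t1 t2 n" for n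
    using Lambda(2)[of n] by (simp add: dilation_def q_def)
  interpret spherical_shalika \<iota> cj \<delta> \<psi> sc' \<Pi>\<^sub>G \<Lambda> \<phi>\<^sub>0
    by (intro spherical_shalika.intro spherical_shalika_axioms.intro ext psi Pi spherical Lambda)
  show ?thesis
    using zeta_integral[OF p t val dh f s[unfolded q_def]] unfolding q_def by blast
qed

end
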